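(* The maximum number of crossing limit cycles that intersect $S^1$ in two points, for piecewise smooth vector fields in $\mathfrak{X}^{S^1}_3\cup \mathfrak{X}^{S^1}_4$, is less than or equal to two. That is: let $Z_{XY}$ be a piecewise smooth vector field with discontinuity set $S^1$, given by an affine vector field $X$ inside $S^1$ and an affine vector field $Y$ outside $S^1$, where $Y$ has a singularity of saddle type with $\operatorname{div}(Y)=0$, and $X$ either has a singularity of center type, or has a singularity of saddle type with $\operatorname{div}(X)=0$. Then $Z_{XY}$ has at most two crossing limit cycles that intersect $S^1$ in two points.
   Context: Let $S^1=\{(x,y)\in\mathbb R^2: x^2+y^2=1\}$ and $h(x,y)=x^2+y^2-1$. Let $U\subset\mathbb R^2$ be an open convex set with $(0,0)\in U$ and $S^1\subset U$. For smooth vector fields $X,Y$ on $U$, $Z_{XY}$ denotes the piecewise smooth vector field equal to $X$ where $h\le 0$ and to $Y$ where $h\ge 0$, with Filippov's convention on $S^1$. Write $Xh=\langle X,\nabla h\rangle$ and $Yh=\langle Y,\nabla h\rangle$. The crossing region is $\{z\in S^1: Xh(z)\,Yh(z)>0\}$; there, trajectories of $X$ and $Y$ are concatenated. A crossing periodic orbit is a closed nonconstant trajectory of $Z_{XY}$, obtained by concatenating arcs of $X$-trajectories in $h\le 0$ and arcs of $Y$-trajectories in $h\ge 0$, that meets $S^1$ only at points of the crossing region. A crossing limit cycle is a crossing periodic orbit having a neighbourhood that contains no other periodic orbit. "Intersects $S^1$ in two points" means in exactly two distinct points. "Linear vector field" means an affine vector field $z\mapsto Az+b$ with $A$ a real $2\times2$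 matrix and $b\in\mathbb R^2$. Its singularity (possibly anywhere in the plane) is of center type if $A$ has nonzero purely imaginary eigenvalues, and of saddle type if $A$ has real eigenvalues of opposite signs. $\mathfrak{X}^{S^1}_3$ is the set of $Z_{XY}$ with $X$ linear with a singularity of center type and $Y$ linear with a singularity of saddle type and $\operatorname{div}(Y)=0$. $\mathfrak{X}^{S^1}_4$ is the set of $Z_{XY}$ with $X$ and $Y$ linear with singularities of saddle type and $\operatorname{div}(X)=\operatorname{div}(Y)=0$. *)

theory Defs
  imports "HOL-Analysis.Analysis"
begin

type_synonym plane = "real ^ 2"
type_synonym vfield = "plane \<Rightarrow> plane"

definition h :: "plane \<Rightarrow> real" where
  "h z = (z $ 1)\<^sup>2 + (z $ 2)\<^sup>2 - 1"

definition S1 :: "plane set" where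
  "S1 = {z. (z $ 1)\<^sup>2 + (z $ 2)\<^sup>2 = 1}"

definition grad_h :: vfield where
  "grad_h z = vector [2 * z $ 1, 2 * z $ 2]"

lemma GDERIV_h: "GDERIV h z :> grad_h z"
proof -
  have "(h has_derivative (\<lambda>v. 2 * z $ 1 * v $ 1 + 2 * z $ 2 * v $ 2)) (at z)"
    unfolding h_def
    by (auto intro!: derivative_eq_intros bounded_linear_imp_has_derivative bounded_linear_vec_nth
        simp: algebra_simps)
  moreover have "(\<lambda>v. 2 * z $ 1 * v $ 1 + 2 * z $ 2 * v $ 2) = (\<lambda>v. v \<bullet> grad_h z)"
    by (simp add: grad_h_def inner_vec_def sum_2 fun_eq_iff algebra_simps)
  ultimately show ?thesis
    by (simp add: gderiv_def)
qed

definition lie_h :: "vfield \<Rightarrow> plane \<Rightarrow> real" where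
  "lie_h X z = X z \<bullet> grad_h z"

definition crossing_region :: "vfield \<Rightarrow> vfield \<Rightarrow> plane set" where
  "crossing_region X Y = {z \<in> S1. lie_h X z * lie_h Y z > 0}"

definition div_field :: "vfield \<Rightarrow> plane \<Rightarrow> real" where
  "div_field X z = (\<Sum>i\<in>UNIV. frechet_derivative X (at z) (axis i 1) $ i)"

text \<open>The set-valued field of Filippov's convention. On the circle it is the convex hull of the
  two values, which yields concatenation at crossing points and the sliding vector field at
  sliding and escaping points.\<close>

definition filippov :: "vfield \<Rightarrow> vfield \<Rightarrow> plane \<Rightarrow> plane set" where
  "filippov X Y z =
     (if h z < 0 then {X z} else if h z > 0 then {Y z} else closed_segment (X z) (Y z))"

text \<open>A solution of the differential inclusion is an absolutely continuous curve whose derivative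
  lies almost everywhere in the set-valued field. It is written here in the equivalent integral
  form; the field has non-empty values, so the density \<open>v\<close> may be changed on a null set so that
  it lies in the field at all times.\<close>

definition trajectory_on ::
  "vfield \<Rightarrow> vfield \<Rightarrow> plane set \<Rightarrow> (real \<Rightarrow> plane) \<Rightarrow> real \<Rightarrow> bool" where
  "trajectory_on X Y U \<gamma> T \<longleftrightarrow>
     \<gamma> ` {0..T} \<subseteq> U \<and>
     (\<exists>v. \<forall>t\<in>{0..T}. v t \<in> filippov X Y (\<gamma> t) \<and> (v has_integral (\<gamma> t - \<gamma> 0)) {0..t})"

definition closed_trajectory ::
  "vfield \<Rightarrow> vfield \<Rightarrow> plane set \<Rightarrow> (real \<Rightarrow> plane) \<Rightarrow> real \<Rightarrow> bool" where
  "closed_trajectory X Y U \<gamma> T \<longleftrightarrow>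
     0 < T \<and> trajectory_on X Y U \<gamma> T \<and> \<gamma> T = \<gamma> 0 \<and> (\<exists>t\<in>{0..T}. \<gamma> t \<noteq> \<gamma> 0)"

text \<open>Orbits are identified with their images in the plane.\<close>

definition periodic_orbit :: "vfield \<Rightarrow> vfield \<Rightarrow> plane set \<Rightarrow> plane set \<Rightarrow> bool" where
  "periodic_orbit X Y U \<Gamma> \<longleftrightarrow> (\<exists>\<gamma> T. closed_trajectory X Y U \<gamma> T \<and> \<Gamma> = \<gamma> ` {0..T})"

definition inner_arc :: "vfield \<Rightarrow> (real \<Rightarrow> plane) \<Rightarrow> real \<Rightarrow> real \<Rightarrow> bool" where
  "inner_arc X \<gamma> a b \<longleftrightarrow>
     (\<forall>t\<in>{a..b}. h (\<gamma> t) \<le> 0 \<and> (\<gamma> has_vector_derivative X (\<gamma> t)) (at t within {a..b}))"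

definition outer_arc :: "vfield \<Rightarrow> (real \<Rightarrow> plane) \<Rightarrow> real \<Rightarrow> real \<Rightarrow> bool" where
  "outer_arc Y \<gamma> a b \<longleftrightarrow>
     (\<forall>t\<in>{a..b}. h (\<gamma> t) \<ge> 0 \<and> (\<gamma> has_vector_derivative Y (\<gamma> t)) (at t within {a..b}))"

definition concatenation_of_arcs ::
  "vfield \<Rightarrow> vfield \<Rightarrow> (real \<Rightarrow> plane) \<Rightarrow> real \<Rightarrow> bool" where
  "concatenation_of_arcs X Y \<gamma> T \<longleftrightarrow>
     (\<exists>n (\<tau> :: nat \<Rightarrow> real). \<tau> 0 = 0 \<and> \<tau> n = T \<and>
        (\<forall>i<n. \<tau> i < \<tau> (Suc i) \<and>
           (inner_arc X \<gamma> (\<tau> i) (\<tau> (Suc i)) \<or> outer_arc Y \<gamma> (\<tau> i) (\<tau> (Suc i)))))"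

definition crossing_periodic_orbit ::
  "vfield \<Rightarrow> vfield \<Rightarrow> plane set \<Rightarrow> plane set \<Rightarrow> bool" where
  "crossing_periodic_orbit X Y U \<Gamma> \<longleftrightarrow>
     (\<exists>\<gamma> T. closed_trajectory X Y U \<gamma> T \<and> concatenation_of_arcs X Y \<gamma> T \<and> \<Gamma> = \<gamma> ` {0..T}) \<and>
     \<Gamma> \<inter> S1 \<subseteq> crossing_region X Y"

definition crossing_limit_cycle ::
  "vfield \<Rightarrow> vfield \<Rightarrow> plane set \<Rightarrow> plane set \<Rightarrow> bool" where
  "crossing_limit_cycle X Y U \<Gamma> \<longleftrightarrow>
     crossing_periodic_orbit X Y U \<Gamma> \<and>
     (\<exists>N. open N \<and> \<Gamma> \<subseteq> N \<and> (\<forall>\<Gamma>'. periodic_orbit X Y U \<Gamma>' \<and> \<Gamma>' \<subseteq> N \<longrightarrow> \<Gamma>' = \<Gamma>))"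

definition eigenvalues :: "real ^ 2 ^ 2 \<Rightarrow> complex set" where
  "eigenvalues A =
     {\<kappa>. \<exists>w :: complex ^ 2. w \<noteq> 0 \<and> map_matrix complex_of_real A *v w = \<kappa> *s w}"

definition center_type :: "real ^ 2 ^ 2 \<Rightarrow> bool" where
  "center_type A \<longleftrightarrow> (\<exists>\<omega> :: real. \<omega> \<noteq> 0 \<and> eigenvalues A = {\<i> * of_real \<omega>, - \<i> * of_real \<omega>})"

definition saddle_type :: "real ^ 2 ^ 2 \<Rightarrow> bool" where
  "saddle_type A \<longleftrightarrow>
     (\<exists>\<mu> \<nu> :: real. \<mu> < 0 \<and> 0 < \<nu> \<and> eigenvalues A = {of_real \<mu>, of_real \<nu>})"

definition linear_center :: "vfield \<Rightarrow> bool" where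
  "linear_center X \<longleftrightarrow> (\<exists>A b. X = (\<lambda>z. A *v z + b) \<and> center_type A)"

definition linear_saddle :: "vfield \<Rightarrow> bool" where
  "linear_saddle X \<longleftrightarrow> (\<exists>A b. X = (\<lambda>z. A *v z + b) \<and> saddle_type A)"

text \<open>A piecewise smooth vector field is represented by the pair of its inner and outer fields.\<close>

definition class3 :: "plane set \<Rightarrow> (vfield \<times> vfield) set" where
  "class3 U = {(X, Y). linear_center X \<and> linear_saddle Y \<and> (\<forall>z\<in>U. div_field Y z = 0)}"

definition class4 :: "plane set \<Rightarrow> (vfield \<times> vfield) set" where
  "class4 U = {(X, Y). linear_saddle X \<and> linear_saddle Y \<and>
     (\<forall>z\<in>U. div_field X z = 0) \<and> (\<forall>z\<in>U. div_field Y z = 0)}"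

end

(* Both fields have the form z |-> L (z - c) with L linear and L (L z) = theta z. A cycle leaves the
   disc at p and re-enters at q. With m = (p + q) / 2 and e = (q - p) / 2, symmetry of an arc about its
   middle time shows that both fields at m are parallel to e, hence orthogonal to m. In the frame u,
   v = perp u in which the outer saddle swaps the axes (L u = Q v, L v = P u with P, Q > 0), the outer
   condition parametrizes m rationally by a real nu, and the inner condition becomes a cubic equation
   in nu. The crossing inequalities place all admissible nu strictly on one side of the cube root of
   the product of the ratios (P - nu) / (Q + nu) over the three roots, so three distinct admissible
   roots force the cubic to vanish identically; then varying nu yields nearby periodic orbits, and
   no orbit is isolated. *)

theory Submission
  imports Defs
begin

text \<open>The parameter \<nu> is the multiplier in
  \<open>L (m - c) = - \<nu> *\<^sub>R perp m\<close>, a linear equation for \<open>m\<close> with a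
  unique solution once \<open>P - \<nu>\<close> and \<open>Q + \<nu>\<close> are nonzero. The chord
  is perpendicular to \<open>m\<close>, its length follows from Pythagoras, and its orientation is
  \<open>sgn \<nu>\<close>, because the flow of a saddle gives a positive factor (a hyperbolic
  cotangent) between \<open>L (m - c)\<close> and the half chord. So \<nu> fixes both circle points,
  and first return along each field then fixes the orbit: counting cycles becomes counting
  admissible roots of a cubic. The delicate case is a cubic that vanishes identically. A nearby
  \<nu> then gives a chord compatible with both fields, but the arcs over it must still be shown to
  exist, to stay on their side of the circle and to stay near the old orbit. Since \<open>h\<close>
  vanishes at the ends of an arc, its sign is not stable there; the end zeros are divided out before
  continuity is used. Centers and saddles are handled together through a generalized cosine and sine
  that depend on the sign of \<theta>.\<close>

lemma h_inner: "h z = z \<bullet> z - 1"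
  by (simp add: h_def inner_vec_def sum_2 power2_eq_square)

lemma S1_iff_inner: "z \<in> S1 \<longleftrightarrow> z \<bullet> z = 1"
  by (simp add: S1_def inner_vec_def sum_2 power2_eq_square)

lemma S1_iff_h: "z \<in> S1 \<longleftrightarrow> h z = 0"
  by (simp add: S1_iff_inner h_inner)

lemma lie_h_inner: "lie_h X z = 2 * (X z \<bullet> z)"
  by (simp add: lie_h_def grad_h_def inner_vec_def sum_2)

section \<open>The quarter turn and orthogonal frames\<close>

definition perp :: "plane \<Rightarrow> plane" where
  "perp z = vector [- z $ 2, z $ 1]"

lemma inner_perp [simp]: "z \<bullet> perp z = 0" "perp z \<bullet> z = 0" "perp w \<bullet> perp z = w \<bullet> z"
  by (simp_all add: perp_def inner_vec_def sum_2)

lemma perp_perp [simp]: "perp (perp z) = - z"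
  by (simp add: perp_def vec_eq_iff forall_2)

lemma orthogonal_imp_perp:
  assumes "m \<noteq> 0" "e \<bullet> m = 0"
  shows "e = ((e \<bullet> perp m) / (m \<bullet> m)) *\<^sub>R perp m"
proof -
  have m: "m \<bullet> m \<noteq> 0" using assms by simp
  have "(m \<bullet> m) *\<^sub>R e = (e \<bullet> perp m) *\<^sub>R perp m + (e \<bullet> m) *\<^sub>R m"
    by (simp add: perp_def inner_vec_def sum_2 vec_eq_iff forall_2 algebra_simps)
  then have "(m \<bullet> m) *\<^sub>R e = (e \<bullet> perp m) *\<^sub>R perp m"
    using assms by simp
  then show ?thesis
    using m by (metis (no_types, lifting) divideR_right divide_inverse_commute scaleR_scaleR)
qed

lemma orthonormal_expansion:
  assumes "u \<bullet> u = 1"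
  shows "z = (z \<bullet> u) *\<^sub>R u + (z \<bullet> perp u) *\<^sub>R perp u"
proof -
  have "(u \<bullet> u) *\<^sub>R z = (z \<bullet> u) *\<^sub>R u + (z \<bullet> perp u) *\<^sub>R perp u"
    by (simp add: perp_def inner_vec_def sum_2 vec_eq_iff forall_2 algebra_simps)
  with assms show ?thesis by simp
qed

text \<open>The square relation is Cayley-Hamilton for trace zero, with \<theta> equal to minus the
  determinant: negative for centers, positive for saddles. The last clause is trace zero itself,
  tested on the orthogonal pair \<open>z\<close>, \<open>perp z\<close>, where the sum is the trace
  times \<open>z \<bullet> z\<close>.\<close>

definition traceless_map :: "(plane \<Rightarrow> plane) \<Rightarrow> real \<Rightarrow> bool" where
  "traceless_map L \<theta> \<longleftrightarrow> linear L \<and> \<theta> \<noteq> 0 \<and> (\<forall>z. L (L z) = \<theta> *\<^sub>R z) \<and>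
     (\<forall>z. z \<bullet> L z + perp z \<bullet> L (perp z) = 0)"

section \<open>Reduction of both spectral types to traceless maps\<close>

lemma eigenvalues_char_poly:
  assumes "\<kappa> \<in> eigenvalues A"
  shows "\<kappa>\<^sup>2 - of_real (A$1$1 + A$2$2) * \<kappa> + of_real (det A) = 0"
proof -
  obtain w :: "complex ^ 2" where w: "w \<noteq> 0" "map_matrix complex_of_real A *v w = \<kappa> *s w"
    using assms by (auto simp: eigenvalues_def)
  let ?c = "\<lambda>i j. complex_of_real (A$i$j)"
  have e1: "?c 1 1 * w$1 + ?c 1 2 * w$2 = \<kappa> * w$1"
    and e2: "?c 2 1 * w$1 + ?c 2 2 * w$2 = \<kappa> * w$2"
    using w(2) by (simp_all add: vec_eq_iff matrix_vector_mult_def sum_2 forall_2 map_matrix_def)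
  let ?P = "\<kappa>\<^sup>2 - of_real (A$1$1 + A$2$2) * \<kappa> + of_real (det A)"
  have "?P * w$1 = 0" "?P * w$2 = 0"
    using e1 e2 by (simp_all add: det_2 power2_eq_square) algebra+
  moreover have "w$1 \<noteq> 0 \<or> w$2 \<noteq> 0"
    using w(1) by (auto simp: vec_eq_iff forall_2)
  ultimately show ?thesis by auto
qed

text \<open>At a purely imaginary eigenvalue the imaginary part of the characteristic equation is
  the trace times \<omega> up to sign, and the real part reads
  \<open>det A = \<omega>\<^sup>2\<close>.\<close>

lemma center_type_imp:
  assumes "center_type A"
  shows "A$1$1 + A$2$2 = 0" "det A > 0"
proof -
  obtain \<omega> :: real where o: "\<omega> \<noteq> 0" "\<i> * of_real \<omega> \<in> eigenvalues A"
    using assms by (auto simp: center_type_def)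
  have c: "(\<i> * of_real \<omega>)\<^sup>2 - of_real (A$1$1 + A$2$2) * (\<i> * of_real \<omega>) + of_real (det A) = 0"
    using eigenvalues_char_poly[OF o(2)] .
  from arg_cong[OF c, of Im] show t: "A$1$1 + A$2$2 = 0"
    using o(1) by (simp add: power2_eq_square)
  from arg_cong[OF c, of Re] have "det A = \<omega>\<^sup>2"
    by (simp add: power2_eq_square)
  then show "det A > 0" using o(1) by simp
qed

lemma saddle_type_imp:
  assumes "saddle_type A" "A$1$1 + A$2$2 = 0"
  shows "det A < 0"
proof -
  obtain \<mu> :: real where o: "\<mu> < 0" "of_real \<mu> \<in> eigenvalues A"
    using assms by (auto simp: saddle_type_def)
  have c: "complex_of_real \<mu> ^ 2 + of_real (det A) = 0"
    using eigenvalues_char_poly[OF o(2)] assms(2) by simp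
  from arg_cong[OF c, of Re] have "det A = - \<mu>\<^sup>2"
    by (simp add: power2_eq_square)
  then show ?thesis using o(1) by simp
qed

lemma div_field_affine:
  fixes A :: "real ^ 2 ^ 2"
  shows "div_field (\<lambda>z. A *v z + b) z = A$1$1 + A$2$2"
proof -
  have "((\<lambda>z. A *v z + b) has_derivative (\<lambda>z. A *v z)) (at z)"
    by (auto intro!: derivative_eq_intros bounded_linear_imp_has_derivative matrix_vector_mul_bounded_linear)
  then have "frechet_derivative (\<lambda>z. A *v z + b) (at z) = (\<lambda>z. A *v z)"
    by (metis frechet_derivative_at)
  then show ?thesis
    by (simp add: div_field_def sum_2 matrix_vector_mult_def axis_def)
qed

lemma traceless_map_matrix:
  fixes A :: "real ^ 2 ^ 2"
  assumes "A$1$1 + A$2$2 = 0" "det A \<noteq> 0"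
  shows "traceless_map (\<lambda>z. A *v z) (- det A)"
proof -
  have A22: "A$2$2 = - A$1$1" using assms by simp
  have "A *v (A *v z) = (- det A) *\<^sub>R z" "z \<bullet> (A *v z) + perp z \<bullet> (A *v perp z) = 0" for z
    by (auto simp: perp_def det_2 A22 matrix_vector_mult_def sum_2 vec_eq_iff
        forall_2 inner_vec_def algebra_simps)
  with assms(2) show ?thesis
    by (simp add: traceless_map_def)
qed

lemma affine_traceless:
  fixes A :: "real ^ 2 ^ 2"
  assumes "A$1$1 + A$2$2 = 0" "det A \<noteq> 0"
  obtains c where "(\<lambda>z. A *v z + b) = (\<lambda>z. A *v (z - c))"
proof -
  have "traceless_map (\<lambda>z. A *v z) (- det A)"
    using traceless_map_matrix[OF assms] .
  then have "A *v (A *v b) = (- det A) *\<^sub>R b"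
    by (simp add: traceless_map_def)
  \<comment> \<open>Since the square of \<open>A\<close> is \<open>- det A\<close>, the inverse of
    \<open>A\<close> is a multiple of \<open>A\<close>; this gives the singularity
    explicitly.\<close>
  then have "A *v ((1 / det A) *\<^sub>R (A *v b)) = - b"
    using assms(2) by (simp add: matrix_vector_mult_scaleR)
  then have "(\<lambda>z. A *v z + b) = (\<lambda>z. A *v (z - (1 / det A) *\<^sub>R (A *v b)))"
    by (simp add: matrix_vector_mult_diff_distrib)
  then show ?thesis using that by blast
qed

lemma linear_center_traceless:
  assumes "linear_center X"
  obtains L \<theta> c where "traceless_map L \<theta>" "X = (\<lambda>z. L (z - c))"
proof -
  obtain A b where X: "X = (\<lambda>z. A *v z + b)" "center_type A"
    using assms by (auto simp: linear_center_def)
  have A: "A$1$1 + A$2$2 = 0" "det A \<noteq> 0"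
    using center_type_imp[OF X(2)] by simp_all
  then show ?thesis
    using affine_traceless[OF A, of b] traceless_map_matrix[OF A] that X(1) by metis
qed

lemma linear_saddle_traceless:
  assumes "linear_saddle X" "div_field X z = 0"
  obtains L \<theta> c where "traceless_map L \<theta>" "\<theta> > 0" "X = (\<lambda>z. L (z - c))"
proof -
  obtain A b where X: "X = (\<lambda>z. A *v z + b)" "saddle_type A"
    using assms by (auto simp: linear_saddle_def)
  have t: "A$1$1 + A$2$2 = 0"
    using assms(2) by (simp add: X(1) div_field_affine)
  have d: "det A < 0" using saddle_type_imp[OF X(2) t] .
  obtain c where "X = (\<lambda>z. A *v (z - c))"
    using affine_traceless[OF t, of b] d X(1) by auto
  then show ?thesis
    using that[OF traceless_map_matrix[OF t]] d by simp
qed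

section \<open>Flows of traceless affine fields\<close>

text \<open>For \<theta> nonzero, \<open>cs \<theta>\<close> and \<open>sn \<theta>\<close> are the
  solutions of y'' = \<theta> y with initial data (1, 0) and (0, 1). Both signs of \<theta> then
  obey the same addition and derivative rules.\<close>

definition cs :: "real \<Rightarrow> real \<Rightarrow> real" where
  "cs \<theta> t = (if \<theta> > 0 then cosh (sqrt \<theta> * t) else cos (sqrt (- \<theta>) * t))"

definition sn :: "real \<Rightarrow> real \<Rightarrow> real" where
  "sn \<theta> t = (if \<theta> > 0 then sinh (sqrt \<theta> * t) / sqrt \<theta> else sin (sqrt (- \<theta>) * t) / sqrt (- \<theta>))"

lemma cs_0 [simp]: "cs \<theta> 0 = 1" and sn_0 [simp]: "sn \<theta> 0 = 0"
  by (simp_all add: cs_def sn_def)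

lemma cs_minus [simp]: "cs \<theta> (- t) = cs \<theta> t" and sn_minus [simp]: "sn \<theta> (- t) = - sn \<theta> t"
  by (simp_all add: cs_def sn_def)

lemma cs_add:
  assumes "\<theta> \<noteq> 0"
  shows "cs \<theta> (s + t) = cs \<theta> s * cs \<theta> t + \<theta> * sn \<theta> s * sn \<theta> t"
proof (cases "\<theta> > 0")
  case True
  then have "\<theta> * sn \<theta> s * sn \<theta> t = sinh (sqrt \<theta> * s) * sinh (sqrt \<theta> * t)"
    by (simp add: sn_def)
  with True show ?thesis by (simp add: cs_def cosh_add distrib_left)
next
  case False
  then have "- (\<theta> * sn \<theta> s * sn \<theta> t) = sin (sqrt (- \<theta>) * s) * sin (sqrt (- \<theta>) * t)"
    using assms by (simp add: sn_def)
  with False show ?thesis by (simp add: cs_def cos_add distrib_left)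
qed

lemma sn_add: "sn \<theta> (s + t) = sn \<theta> s * cs \<theta> t + cs \<theta> s * sn \<theta> t"
  by (simp add: cs_def sn_def sinh_add sin_add distrib_left add_divide_distrib)

lemma cs_sn_square: "\<theta> \<noteq> 0 \<Longrightarrow> (cs \<theta> t)\<^sup>2 - \<theta> * (sn \<theta> t)\<^sup>2 = 1"
  using cs_add[of \<theta> t "- t", symmetric] by (simp add: power2_eq_square algebra_simps)

text \<open>Subtracting the addition laws at half sum plus and minus half difference. This product
  form later exposes the zeros of \<open>h\<close> at both ends of an arc.\<close>

lemma cs_diff_prod:
  assumes "\<theta> \<noteq> 0"
  shows "cs \<theta> t - cs \<theta> s = - 2 * \<theta> * sn \<theta> ((s + t) / 2) * sn \<theta> ((s - t) / 2)"
proof -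
  have "cs \<theta> (a + - b) - cs \<theta> (a + b) = - 2 * \<theta> * sn \<theta> a * sn \<theta> b" for a b
    unfolding cs_add[OF assms] by simp
  from this[of "(s + t) / 2" "(s - t) / 2"] show ?thesis
    by (simp add: field_simps)
qed

lemma cs_has_derivative:
  assumes "\<theta> \<noteq> 0"
  shows "(cs \<theta> has_real_derivative \<theta> * sn \<theta> t) (at t within S)"
proof (cases "\<theta> > 0")
  case True
  have "((\<lambda>x. cosh (sqrt \<theta> * x)) has_real_derivative sinh (sqrt \<theta> * t) * sqrt \<theta>) (at t within S)"
    by (auto intro!: derivative_eq_intros)
  moreover have "\<theta> * sn \<theta> t = sinh (sqrt \<theta> * t) * sqrt \<theta>"
  proof -
    have "\<theta> * sn \<theta> t = sinh (sqrt \<theta> * t) * (\<theta> / sqrt \<theta>)"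
      using True by (simp add: sn_def)
    then show ?thesis using True real_div_sqrt[of \<theta>] by simp
  qed
  moreover have "cs \<theta> = (\<lambda>x. cosh (sqrt \<theta> * x))"
    using True by (simp add: cs_def fun_eq_iff)
  ultimately show ?thesis by simp
next
  case False
  have "((\<lambda>x. cos (sqrt (- \<theta>) * x)) has_real_derivative - sin (sqrt (- \<theta>) * t) * sqrt (- \<theta>)) (at t within S)"
    by (auto intro!: derivative_eq_intros)
  moreover have "\<theta> * sn \<theta> t = - sin (sqrt (- \<theta>) * t) * sqrt (- \<theta>)"
  proof -
    have "\<theta> * sn \<theta> t = - (sin (sqrt (- \<theta>) * t) * (- \<theta> / sqrt (- \<theta>)))"
      using False by (simp add: sn_def)
    moreover have "- \<theta> / sqrt (- \<theta>) = sqrt (- \<theta>)"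
      using False real_div_sqrt[of "- \<theta>"] by simp
    ultimately show ?thesis by (simp only: minus_mult_left)
  qed
  moreover have "cs \<theta> = (\<lambda>x. cos (sqrt (- \<theta>) * x))"
    using False by (simp add: cs_def fun_eq_iff)
  ultimately show ?thesis by simp
qed

lemma sn_has_derivative:
  assumes "\<theta> \<noteq> 0"
  shows "(sn \<theta> has_real_derivative cs \<theta> t) (at t within S)"
proof (cases "\<theta> > 0")
  case True
  have "((\<lambda>x. sinh (sqrt \<theta> * x) / sqrt \<theta>) has_real_derivative cosh (sqrt \<theta> * t) * sqrt \<theta> / sqrt \<theta>) (at t within S)"
    by (intro DERIV_cdivide) (auto intro!: derivative_eq_intros)
  moreover have "cs \<theta> t = cosh (sqrt \<theta> * t) * sqrt \<theta> / sqrt \<theta>"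
    using True by (simp add: cs_def)
  moreover have "sn \<theta> = (\<lambda>x. sinh (sqrt \<theta> * x) / sqrt \<theta>)"
    using True by (simp add: sn_def fun_eq_iff)
  ultimately show ?thesis by simp
next
  case False
  have "((\<lambda>x. sin (sqrt (- \<theta>) * x) / sqrt (- \<theta>)) has_real_derivative cos (sqrt (- \<theta>) * t) * sqrt (- \<theta>) / sqrt (- \<theta>)) (at t within S)"
    by (intro DERIV_cdivide) (auto intro!: derivative_eq_intros)
  moreover have "cs \<theta> t = cos (sqrt (- \<theta>) * t) * sqrt (- \<theta>) / sqrt (- \<theta>)"
    using False assms by (simp add: cs_def)
  moreover have "sn \<theta> = (\<lambda>x. sin (sqrt (- \<theta>) * x) / sqrt (- \<theta>))"
    using False by (simp add: sn_def fun_eq_iff)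
  ultimately show ?thesis by simp
qed

lemma cs_continuous_on [continuous_intros]:
  "\<theta> \<noteq> 0 \<Longrightarrow> continuous_on S f \<Longrightarrow> continuous_on S (\<lambda>x. cs \<theta> (f x))"
  using continuous_on_compose2[of UNIV "cs \<theta>" S f] DERIV_continuous_on[OF cs_has_derivative] by blast

lemma sn_continuous_on [continuous_intros]:
  "\<theta> \<noteq> 0 \<Longrightarrow> continuous_on S f \<Longrightarrow> continuous_on S (\<lambda>x. sn \<theta> (f x))"
  using continuous_on_compose2[of UNIV "sn \<theta>" S f] DERIV_continuous_on[OF sn_has_derivative] by blast

lemma cs_pos: "\<theta> > 0 \<Longrightarrow> cs \<theta> t > 0"
  by (simp add: cs_def)

lemma sn_pos: "\<theta> > 0 \<Longrightarrow> t > 0 \<Longrightarrow> sn \<theta> t > 0"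
  by (simp add: sn_def)

lemma tanh_artanh_real:
  fixes x :: real
  assumes "\<bar>x\<bar> < 1"
  shows "tanh (artanh x) = x"
proof -
  define y where "y = (1 + x) / (1 - x)"
  have y: "y > 0" using assms by (simp add: y_def)
  have "artanh x = ln (sqrt y)"
    using y by (simp add: artanh_def y_def[symmetric] ln_sqrt)
  then have "tanh (artanh x) = (y - 1) / (y + 1)"
    using y by (simp add: tanh_ln_real)
  moreover have "y - 1 = 2 * x / (1 - x)" "y + 1 = 2 / (1 - x)"
    using assms by (simp_all add: y_def field_simps)
  ultimately show ?thesis using assms by simp
qed

text \<open>Half the flight time, as a continuous function of the multiplier \<open>cs / sn\<close>:
  an inverse hyperbolic cotangent for saddles, an inverse cotangent for centers. Positivity of
  \<open>sn\<close> up to \<open>\<tau>\<close> selects the branch below the first positive zero of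
  \<open>sn\<close>.\<close>

lemma half_time_inverse:
  assumes "\<theta> \<noteq> 0" "0 < \<tau>" "\<And>t. 0 < t \<Longrightarrow> t \<le> \<tau> \<Longrightarrow> sn \<theta> t > 0"
  obtains T where "isCont T (cs \<theta> \<tau> / sn \<theta> \<tau>)" "T (cs \<theta> \<tau> / sn \<theta> \<tau>) = \<tau>"
    "\<forall>\<^sub>F \<kappa> in nhds (cs \<theta> \<tau> / sn \<theta> \<tau>). 0 < T \<kappa> \<and> cs \<theta> (T \<kappa>) = \<kappa> * sn \<theta> (T \<kappa>) \<and>
       (\<forall>t. 0 < t \<longrightarrow> t \<le> T \<kappa> \<longrightarrow> sn \<theta> t > 0)"
proof (cases "\<theta> > 0")
  case True
  define r where "r = sqrt \<theta>"
  have r: "r > 0" using True by (simp add: r_def)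
  define k where "k = cs \<theta> \<tau> / sn \<theta> \<tau>"
  define T where "T \<kappa> = artanh (r / \<kappa>) / r" for \<kappa>
  have k: "k > 0" using cs_pos[OF True] sn_pos[OF True assms(2)] by (simp add: k_def)
  have th: "r / k = tanh (r * \<tau>)"
    using True r by (simp add: k_def cs_def sn_def tanh_def r_def)
  then have rk: "r < k"
    using tanh_real_lt_1[of "r * \<tau>"] k by (metis divide_less_eq_1_pos)
  have cont: "isCont T k"
    unfolding T_def using k r rk by (intro continuous_intros) (auto simp: field_simps)
  have Tk: "T k = \<tau>" using r by (simp add: T_def th artanh_tanh_real)
  have ev: "\<forall>\<^sub>F \<kappa> in nhds k. \<kappa> > r"
    using rk by (metis eventually_nhds open_greaterThan greaterThan_iff)
  show ?thesis
  proof (rule that[of T])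
    show "\<forall>\<^sub>F \<kappa> in nhds (cs \<theta> \<tau> / sn \<theta> \<tau>). 0 < T \<kappa> \<and> cs \<theta> (T \<kappa>) = \<kappa> * sn \<theta> (T \<kappa>) \<and>
       (\<forall>t. 0 < t \<longrightarrow> t \<le> T \<kappa> \<longrightarrow> sn \<theta> t > 0)"
      unfolding k_def[symmetric] using ev
    proof eventually_elim
      case (elim \<kappa>)
      have b: "0 < r / \<kappa>" "r / \<kappa> < 1" using elim r by auto
      have t: "tanh (r * T \<kappa>) = r / \<kappa>" using tanh_artanh_real b r by (simp add: T_def)
      have "T \<kappa> > 0"
      proof -
        have "tanh (r * T \<kappa>) > 0" using t b by simp
        then show ?thesis using r by (simp add: zero_less_mult_iff)
      qed
      moreover have "cs \<theta> (T \<kappa>) = \<kappa> * sn \<theta> (T \<kappa>)"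
        using t True elim r cosh_real_pos[of "r * T \<kappa>"]
        by (simp add: cs_def sn_def r_def[symmetric] tanh_def field_simps)
      ultimately show ?case using sn_pos[OF True] by auto
    qed
  qed (use cont Tk k_def in auto)
next
  case False
  define r where "r = sqrt (- \<theta>)"
  have r: "r > 0" using False assms by (simp add: r_def)
  define k where "k = cs \<theta> \<tau> / sn \<theta> \<tau>"
  \<comment> \<open>The inverse cotangent with values strictly between 0 and \<open>pi\<close>,
    rescaled by the frequency \<open>r\<close>.\<close>
  define T where "T \<kappa> = (pi / 2 - arctan (\<kappa> / r)) / r" for \<kappa>
  have pi: "r * \<tau> < pi"
  proof (rule ccontr)
    assume "\<not> r * \<tau> < pi"
    \<comment> \<open>The first positive zero of \<open>sn\<close> is at
      \<open>pi / r\<close>.\<close>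
    then have "sn \<theta> (pi / r) > 0" using r by (intro assms(3)) (auto simp: field_simps)
    then show False using False r by (simp add: sn_def r_def[symmetric])
  qed
  have pos: "r * \<tau> > 0" using r assms by simp
  have "k / r = cos (r * \<tau>) / sin (r * \<tau>)"
    using False r by (simp add: k_def cs_def sn_def r_def)
  also have "\<dots> = tan (pi / 2 - r * \<tau>)"
    by (simp add: tan_def sin_diff cos_diff)
  finally have "arctan (k / r) = pi / 2 - r * \<tau>"
    using arctan_tan[of "pi / 2 - r * \<tau>"] pi pos by simp
  then have Tk: "T k = \<tau>" using r by (simp add: T_def)
  have cont: "isCont T k"
    unfolding T_def using r by (intro continuous_intros) auto
  have "0 < T \<kappa> \<and> cs \<theta> (T \<kappa>) = \<kappa> * sn \<theta> (T \<kappa>) \<and> (\<forall>t. 0 < t \<longrightarrow> t \<le> T \<kappa> \<longrightarrow> sn \<theta> t > 0)" for \<kappa>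
  proof -
    have b: "r * T \<kappa> = pi / 2 - arctan (\<kappa> / r)" using r by (simp add: T_def)
    have ar: "- (pi/2) < arctan (\<kappa> / r)" "arctan (\<kappa> / r) < pi/2"
      using arctan_lbound arctan_ubound by auto
    have "0 < r * T \<kappa>" "r * T \<kappa> < pi" using b ar by linarith+
    then have "0 < T \<kappa>" using r by (simp add: zero_less_mult_iff)
    moreover have "sn \<theta> t > 0" if "0 < t" "t \<le> T \<kappa>" for t
    proof -
      have "r * t \<le> r * T \<kappa>" using that r by simp
      then have "0 < r * t" "r * t < pi" using that r \<open>r * T \<kappa> < pi\<close> by (auto, linarith)
      then have "sin (r * t) > 0" by (rule sin_gt_zero)
      then show ?thesis using False r by (simp add: sn_def r_def[symmetric])
    qed
    moreover have "cs \<theta> (T \<kappa>) = \<kappa> * sn \<theta> (T \<kappa>)"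
    proof -
      have "sin (arctan (\<kappa> / r)) = \<kappa> / r * cos (arctan (\<kappa> / r))"
        using tan_arctan[of "\<kappa> / r"] cos_arctan_not_zero[of "\<kappa> / r"] by (simp add: tan_def divide_eq_eq)
      then show ?thesis
        using False by (simp add: cs_def sn_def r_def[symmetric] b sin_diff cos_diff)
    qed
    ultimately show ?thesis by auto
  qed
  then show ?thesis
    using that[of T] cont Tk by (simp add: k_def)
qed

text \<open>The exponential of \<open>t L\<close> about the singularity \<open>c\<close>: as the
  square of \<open>L\<close> is \<theta>, the exponential series collapses to \<open>cs\<close>
  times the identity plus \<open>sn\<close> times \<open>L\<close>.\<close>

definition flow :: "(plane \<Rightarrow> plane) \<Rightarrow> real \<Rightarrow> plane \<Rightarrow> real \<Rightarrow> plane \<Rightarrow> plane" where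
  "flow L \<theta> c t z = c + cs \<theta> t *\<^sub>R (z - c) + sn \<theta> t *\<^sub>R L (z - c)"

lemma traceless_mapD:
  assumes "traceless_map L \<theta>"
  shows "linear L" "bounded_linear L" "\<theta> \<noteq> 0" "L (L z) = \<theta> *\<^sub>R z" "z \<bullet> L z + perp z \<bullet> L (perp z) = 0"
  using assms by (auto simp: traceless_map_def linear_conv_bounded_linear)

lemma flow_0 [simp]: "flow L \<theta> c 0 z = z"
  by (simp add: flow_def)

lemma L_flow:
  assumes "traceless_map L \<theta>"
  shows "L (flow L \<theta> c t z - c) = cs \<theta> t *\<^sub>R L (z - c) + (\<theta> * sn \<theta> t) *\<^sub>R (z - c)"
  using traceless_mapD[OF assms]
  by (simp add: flow_def linear_add linear_scale mult.commute)

lemma flow_add: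
  assumes "traceless_map L \<theta>"
  shows "flow L \<theta> c s (flow L \<theta> c t z) = flow L \<theta> c (s + t) z"
proof -
  have "flow L \<theta> c s (flow L \<theta> c t z) = c + cs \<theta> s *\<^sub>R (flow L \<theta> c t z - c) + sn \<theta> s *\<^sub>R L (flow L \<theta> c t z - c)"
    by (simp add: flow_def)
  also have "\<dots> = c + cs \<theta> s *\<^sub>R (cs \<theta> t *\<^sub>R (z - c) + sn \<theta> t *\<^sub>R L (z - c)) +
      sn \<theta> s *\<^sub>R (cs \<theta> t *\<^sub>R L (z - c) + (\<theta> * sn \<theta> t) *\<^sub>R (z - c))"
    unfolding L_flow[OF assms] by (simp add: flow_def)
  also have "\<dots> = flow L \<theta> c (s + t) z"
    unfolding flow_def cs_add[OF traceless_mapD(3)[OF assms]] sn_add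
    by (simp add: algebra_simps)
  finally show ?thesis .
qed

lemma flow_has_vector_derivative:
  assumes "traceless_map L \<theta>"
  shows "((\<lambda>t. flow L \<theta> c t z) has_vector_derivative L (flow L \<theta> c t z - c)) (at t within S)"
proof -
  have c: "(cs \<theta> has_real_derivative \<theta> * sn \<theta> t) (at t within S)"
    and s: "(sn \<theta> has_real_derivative cs \<theta> t) (at t within S)"
    using cs_has_derivative sn_has_derivative traceless_mapD(3)[OF assms] by auto
  have "((\<lambda>t. c + cs \<theta> t *\<^sub>R (z - c) + sn \<theta> t *\<^sub>R L (z - c)) has_vector_derivative
      0 + (\<theta> * sn \<theta> t) *\<^sub>R (z - c) + cs \<theta> t *\<^sub>R L (z - c)) (at t within S)"
    by (intro has_vector_derivative_add has_vector_derivative_const)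
      (auto intro!: derivative_eq_intros c s)
  then show ?thesis
    unfolding L_flow[OF assms] by (simp add: flow_def add.commute)
qed

text \<open>Transporting \<open>\<gamma> s\<close> back to time \<open>a\<close> by the explicit
  flow gives a curve \<open>?G\<close> with zero derivative, hence a constant. Derivatives within
  the closed interval are enough, which fits arcs with one-sided derivatives at their ends.\<close>

lemma flow_unique:
  assumes L: "traceless_map L \<theta>" and t: "t \<in> {a..b}"
    and \<gamma>: "\<And>s. s \<in> {a..b} \<Longrightarrow> (\<gamma> has_vector_derivative L (\<gamma> s - c)) (at s within {a..b})"
  shows "\<gamma> t = flow L \<theta> c (t - a) (\<gamma> a)"
proof -
  note bl = traceless_mapD(2)[OF L]
  have nz: "\<theta> \<noteq> 0" and lin: "linear L" using traceless_mapD[OF L] by auto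
  let ?G = "\<lambda>s. c + cs \<theta> (a - s) *\<^sub>R (\<gamma> s - c) + sn \<theta> (a - s) *\<^sub>R L (\<gamma> s - c)"
  have "(?G has_vector_derivative 0) (at s within {a..b})" if s: "s \<in> {a..b}" for s
  proof -
    have c: "((\<lambda>s. cs \<theta> (a - s)) has_real_derivative - (\<theta> * sn \<theta> (a - s))) (at s within {a..b})"
      by (rule DERIV_chain2[where f = "cs \<theta>" and g = "\<lambda>s. a - s" and Db = "- 1", THEN DERIV_cong, OF cs_has_derivative[OF nz]])
        (auto intro!: derivative_eq_intros)
    have s': "((\<lambda>s. sn \<theta> (a - s)) has_real_derivative - cs \<theta> (a - s)) (at s within {a..b})"
      by (rule DERIV_chain2[where f = "sn \<theta>" and g = "\<lambda>s. a - s" and Db = "- 1", THEN DERIV_cong, OF sn_has_derivative[OF nz]])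
        (auto intro!: derivative_eq_intros)
    have g: "((\<lambda>s. \<gamma> s - c) has_vector_derivative L (\<gamma> s - c)) (at s within {a..b})"
      using \<gamma>[OF s] by (auto intro!: derivative_eq_intros)
    have Lg: "((\<lambda>s. L (\<gamma> s - c)) has_vector_derivative \<theta> *\<^sub>R (\<gamma> s - c)) (at s within {a..b})"
      using bounded_linear.has_vector_derivative[OF bl g] traceless_mapD(4)[OF L] by simp
    have "(?G has_vector_derivative 0 + (cs \<theta> (a - s) *\<^sub>R L (\<gamma> s - c) + (- (\<theta> * sn \<theta> (a - s))) *\<^sub>R (\<gamma> s - c)) +
       (sn \<theta> (a - s) *\<^sub>R \<theta> *\<^sub>R (\<gamma> s - c) + (- cs \<theta> (a - s)) *\<^sub>R L (\<gamma> s - c))) (at s within {a..b})"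
      by (intro has_vector_derivative_add has_vector_derivative_const has_vector_derivative_scaleR c s' g Lg)
    then show ?thesis by (simp add: algebra_simps)
  qed
  then obtain k where k: "\<And>s. s \<in> {a..b} \<Longrightarrow> ?G s = k"
    using has_vector_derivative_zero_constant[of "{a..b}" ?G] by auto
  have "flow L \<theta> c (a - t) (\<gamma> t) = ?G t" by (simp add: flow_def)
  also have "\<dots> = ?G a" using k[OF t] k[of a] t by simp
  finally have "flow L \<theta> c (a - t) (\<gamma> t) = \<gamma> a" by simp
  then show ?thesis
    using flow_add[OF L, of c "t - a" "a - t" "\<gamma> t"] by simp
qed

section \<open>Arcs between points of the circle\<close>

text \<open>The sign \<open>\<sigma>\<close> is \<open>1\<close> for arcs outside the disc and \<open>- 1\<close> for arcs inside it.\<close>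

definition arc_from ::
  "(plane \<Rightarrow> plane) \<Rightarrow> real \<Rightarrow> plane \<Rightarrow> real \<Rightarrow> plane \<Rightarrow> plane \<Rightarrow> real \<Rightarrow> bool" where
  "arc_from L \<theta> c \<sigma> p q a \<longleftrightarrow> 0 < a \<and> p \<in> S1 \<and> q \<in> S1 \<and> flow L \<theta> c a p = q \<and>
     (\<forall>t\<in>{0<..<a}. 0 < \<sigma> * h (flow L \<theta> c t p)) \<and>
     0 < \<sigma> * (L (p - c) \<bullet> p) \<and> \<sigma> * (L (q - c) \<bullet> q) < 0"

lemma arc_from_neq: "arc_from L \<theta> c \<sigma> p q a \<Longrightarrow> p \<noteq> q"
  by (auto simp: arc_from_def)

text \<open>The duration is the first positive time at which the flow returns to the circle, since
  \<open>h\<close> is nonzero strictly before it.\<close>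

lemma arc_from_unique:
  assumes "arc_from L \<theta> c \<sigma> p q a" "arc_from L \<theta> c \<sigma> p q' a'"
  shows "a = a' \<and> q = q'"
proof -
  have "a = a'"
  proof (rule ccontr)
    assume "a \<noteq> a'"
    then consider "a < a'" | "a' < a" by linarith
    then show False
    proof cases
      case 1
      then have "0 < \<sigma> * h (flow L \<theta> c a p)" using assms by (auto simp: arc_from_def)
      then show False using assms(1) by (simp add: arc_from_def S1_iff_h)
    next
      case 2
      then have "0 < \<sigma> * h (flow L \<theta> c a' p)" using assms by (auto simp: arc_from_def)
      then show False using assms(2) by (simp add: arc_from_def S1_iff_h)
    qed
  qed
  with assms show ?thesis by (auto simp: arc_from_def)
qed

text \<open>An arc of a center lasts less than a full period: after a period the flow is back at
  \<open>p\<close>, on the circle, which neither an interior point nor the end point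
  \<open>q\<close> of the arc can be. Half the duration therefore stays below the first zero of
  \<open>sn\<close>.\<close>

lemma arc_from_sn_pos:
  assumes L: "traceless_map L \<theta>" and arc: "arc_from L \<theta> c \<sigma> p q a"
    and t: "0 < t" "t \<le> a / 2"
  shows "sn \<theta> t > 0"
proof (cases "\<theta> > 0")
  case True
  then show ?thesis using sn_pos t by simp
next
  case False
  define r where "r = sqrt (- \<theta>)"
  have r: "r > 0" using False traceless_mapD(3)[OF L] by (simp add: r_def)
  have period: "flow L \<theta> c (2 * pi / r) p = p"
    using False r by (simp add: flow_def cs_def sn_def r_def[symmetric])
  have "a < 2 * pi / r"
  proof (rule ccontr)
    assume "\<not> a < 2 * pi / r"
    then consider "a = 2 * pi / r" | "2 * pi / r < a" by linarith
    then show False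
    proof cases
      case 1
      then show False using period arc arc_from_neq[OF arc] by (simp add: arc_from_def)
    next
      case 2
      then have "0 < \<sigma> * h (flow L \<theta> c (2 * pi / r) p)"
        using arc r by (auto simp: arc_from_def)
      then show False using period arc by (simp add: arc_from_def S1_iff_h)
    qed
  qed
  then have "r * a < 2 * pi" using r by (simp add: field_simps)
  moreover have "r * t \<le> r * (a / 2)" using r t by (intro mult_left_mono) auto
  ultimately have "r * t < pi" by simp
  moreover have "0 < r * t" using r t by simp
  ultimately have "sin (r * t) > 0" by (rule sin_gt_zero[rotated])
  then show ?thesis using False r by (simp add: sn_def r_def[symmetric])
qed

text \<open>Here \<open>c + w\<close> is the position at time \<open>\<tau>\<close>. With time
  counted from there, the motion splits into an even part along \<open>w\<close> and an odd part
  along \<open>L w\<close>.\<close>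

lemma flow_centered:
  assumes L: "traceless_map L \<theta>" and p: "p = c + cs \<theta> \<tau> *\<^sub>R w - sn \<theta> \<tau> *\<^sub>R L w"
  shows "flow L \<theta> c (\<tau> + s) p = c + cs \<theta> s *\<^sub>R w + sn \<theta> s *\<^sub>R L w"
proof -
  have "p = flow L \<theta> c (- \<tau>) (c + w)" by (simp add: p flow_def)
  then have "flow L \<theta> c (\<tau> + s) p = flow L \<theta> c s (c + w)"
    by (simp add: flow_add[OF L])
  then show ?thesis by (simp add: flow_def)
qed

lemma arc_from_centered:
  assumes L: "traceless_map L \<theta>" and arc: "arc_from L \<theta> c \<sigma> p q a"
  obtains w where "p = c + cs \<theta> (a/2) *\<^sub>R w - sn \<theta> (a/2) *\<^sub>R L w"
    "q = c + cs \<theta> (a/2) *\<^sub>R w + sn \<theta> (a/2) *\<^sub>R L w"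
proof -
  define w where "w = flow L \<theta> c (a/2) p - c"
  have "p = flow L \<theta> c (- (a/2)) (c + w)" by (simp add: w_def flow_add[OF L])
  then have p: "p = c + cs \<theta> (a/2) *\<^sub>R w - sn \<theta> (a/2) *\<^sub>R L w" by (simp add: flow_def)
  have "q = flow L \<theta> c (a/2 + a/2) p" using arc by (simp add: arc_from_def)
  also have "\<dots> = c + cs \<theta> (a/2) *\<^sub>R w + sn \<theta> (a/2) *\<^sub>R L w"
    using flow_centered[OF L p] .
  finally show ?thesis using that p by blast
qed

text \<open>In centred time the even part at the end is the chord midpoint minus \<open>c\<close>,
  and the odd part is the half chord. \<open>L\<close> carries the direction \<open>w\<close> of the
  former to the direction \<open>L w\<close> of the latter.\<close>

lemma arc_from_chord:
  assumes L: "traceless_map L \<theta>" and arc: "arc_from L \<theta> c \<sigma> p q a"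
  shows "L ((1/2) *\<^sub>R (p + q) - c) = (cs \<theta> (a/2) / sn \<theta> (a/2)) *\<^sub>R ((1/2) *\<^sub>R (q - p))"
    and "sn \<theta> (a/2) > 0"
proof -
  obtain w where w: "p = c + cs \<theta> (a/2) *\<^sub>R w - sn \<theta> (a/2) *\<^sub>R L w"
    "q = c + cs \<theta> (a/2) *\<^sub>R w + sn \<theta> (a/2) *\<^sub>R L w"
    using arc_from_centered[OF L arc] .
  show sn: "sn \<theta> (a/2) > 0"
    using arc_from_sn_pos[OF L arc, of "a/2"] arc by (simp add: arc_from_def)
  have "(1/2) *\<^sub>R (p + q) - c = cs \<theta> (a/2) *\<^sub>R w"
    unfolding w by (simp add: vec_eq_iff field_simps)
  moreover have "(1/2) *\<^sub>R (q - p) = sn \<theta> (a/2) *\<^sub>R L w"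
    unfolding w by (simp add: vec_eq_iff field_simps)
  ultimately show "L ((1/2) *\<^sub>R (p + q) - c) = (cs \<theta> (a/2) / sn \<theta> (a/2)) *\<^sub>R ((1/2) *\<^sub>R (q - p))"
    using sn traceless_mapD(1)[OF L] by (simp add: linear_scale)
qed

text \<open>The cofactor of \<open>cs \<theta> t - cs \<theta> \<tau>\<close> in
  \<open>\<theta> * h\<close> along an arc in centred time. The extra factor \<theta> allows the
  square of \<open>sn\<close> to be replaced by that of \<open>cs\<close> without a
  division.\<close>

definition arc_factor :: "(plane \<Rightarrow> plane) \<Rightarrow> real \<Rightarrow> plane \<Rightarrow> plane \<Rightarrow> real \<Rightarrow> real \<Rightarrow> real" where
  "arc_factor L \<theta> c w \<tau> t =
     \<theta> * (2 * (c \<bullet> w) + (cs \<theta> t + cs \<theta> \<tau>) * (w \<bullet> w)) + (cs \<theta> t + cs \<theta> \<tau>) * (L w \<bullet> L w) +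
     2 * \<theta> * sn \<theta> t * (w \<bullet> L w)"

lemma h_expand:
  "h (c + C *\<^sub>R w + S *\<^sub>R v) =
     c \<bullet> c - 1 + 2 * C * (c \<bullet> w) + 2 * S * (c \<bullet> v) + C\<^sup>2 * (w \<bullet> w) + S\<^sup>2 * (v \<bullet> v) + 2 * C * S * (w \<bullet> v)"
  by (simp add: h_inner inner_add_left inner_add_right inner_commute power2_eq_square algebra_simps)

text \<open>Along the arc both \<open>\<plusminus>\<tau>\<close> are zeros of \<open>h\<close>, which is quadratic in \<open>cs\<close> and \<open>sn\<close>; dividing
  them out turns a sign condition that is weak at the end points into a strict one on a compact
  interval, and strict conditions survive small perturbations.\<close>

lemma arc_factorization:
  assumes L: "traceless_map L \<theta>" and sn: "sn \<theta> \<tau> \<noteq> 0"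
    and p: "h (c + cs \<theta> \<tau> *\<^sub>R w - sn \<theta> \<tau> *\<^sub>R L w) = 0"
    and q: "h (c + cs \<theta> \<tau> *\<^sub>R w + sn \<theta> \<tau> *\<^sub>R L w) = 0"
  shows "h (c + cs \<theta> t *\<^sub>R w + sn \<theta> t *\<^sub>R L w) =
      - 2 * sn \<theta> ((\<tau> + t) / 2) * sn \<theta> ((\<tau> - t) / 2) * arc_factor L \<theta> c w \<tau> t" (is ?A)
    and "2 * (L (c + cs \<theta> \<tau> *\<^sub>R w + sn \<theta> \<tau> *\<^sub>R L w - c) \<bullet> (c + cs \<theta> \<tau> *\<^sub>R w + sn \<theta> \<tau> *\<^sub>R L w)) =
      sn \<theta> \<tau> * arc_factor L \<theta> c w \<tau> \<tau>" (is ?B)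
    and "2 * (L (c + cs \<theta> \<tau> *\<^sub>R w - sn \<theta> \<tau> *\<^sub>R L w - c) \<bullet> (c + cs \<theta> \<tau> *\<^sub>R w - sn \<theta> \<tau> *\<^sub>R L w)) =
      - (sn \<theta> \<tau> * arc_factor L \<theta> c w \<tau> (- \<tau>))" (is ?C)
proof -
  have \<theta>: "\<theta> \<noteq> 0" and lin: "linear L" and LL: "\<And>z. L (L z) = \<theta> *\<^sub>R z"
    using traceless_mapD[OF L] by auto
  define C S where "C = cs \<theta> \<tau>" and "S = sn \<theta> \<tau>"
  have p': "c \<bullet> c - 1 + 2 * C * (c \<bullet> w) - 2 * S * (c \<bullet> L w) + C\<^sup>2 * (w \<bullet> w) + S\<^sup>2 * (L w \<bullet> L w) - 2 * C * S * (w \<bullet> L w) = 0"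
    using p h_expand[of c C w "- S" "L w"] by (simp add: C_def S_def)
  have q': "c \<bullet> c - 1 + 2 * C * (c \<bullet> w) + 2 * S * (c \<bullet> L w) + C\<^sup>2 * (w \<bullet> w) + S\<^sup>2 * (L w \<bullet> L w) + 2 * C * S * (w \<bullet> L w) = 0"
    using q h_expand[of c C w S "L w"] by (simp add: C_def S_def)
  \<comment> \<open>The difference of the two end conditions isolates the part odd in
    \<open>S\<close>; their sum isolates the even part.\<close>
  have "S * (c \<bullet> L w + C * (w \<bullet> L w)) = 0"
    using p' q' by (simp add: algebra_simps)
  then have odd: "c \<bullet> L w = - C * (w \<bullet> L w)"
    using sn by (simp add: S_def)
  have even: "c \<bullet> c - 1 + 2 * C * (c \<bullet> w) + C\<^sup>2 * (w \<bullet> w) + S\<^sup>2 * (L w \<bullet> L w) = 0"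
    using p' q' by (simp add: algebra_simps)
  have S2: "\<theta> * S\<^sup>2 = C\<^sup>2 - 1" using cs_sn_square[OF \<theta>, of \<tau>] by (simp add: C_def S_def)
  show ?A
  proof -
    define c1 s1 where "c1 = cs \<theta> t" and "s1 = sn \<theta> t"
    have s2: "\<theta> * s1\<^sup>2 = c1\<^sup>2 - 1" using cs_sn_square[OF \<theta>, of t] by (simp add: c1_def s1_def)
    have "\<theta> * h (c + c1 *\<^sub>R w + s1 *\<^sub>R L w) = (c1 - C) * arc_factor L \<theta> c w \<tau> t"
    proof -
      have "h (c + c1 *\<^sub>R w + s1 *\<^sub>R L w) = 2 * (c1 - C) * (c \<bullet> w) + 2 * s1 * (c1 - C) * (w \<bullet> L w) +
          (c1\<^sup>2 - C\<^sup>2) * (w \<bullet> w) + (s1\<^sup>2 - S\<^sup>2) * (L w \<bullet> L w)"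
        unfolding h_expand using odd even by (simp add: algebra_simps)
      then have "\<theta> * h (c + c1 *\<^sub>R w + s1 *\<^sub>R L w) = \<theta> * (2 * (c1 - C) * (c \<bullet> w) + 2 * s1 * (c1 - C) * (w \<bullet> L w) +
          (c1\<^sup>2 - C\<^sup>2) * (w \<bullet> w)) + (\<theta> * s1\<^sup>2 - \<theta> * S\<^sup>2) * (L w \<bullet> L w)"
        by (simp only:) (simp add: algebra_simps)
      also have "\<dots> = (c1 - C) * arc_factor L \<theta> c w \<tau> t"
        unfolding S2 s2 arc_factor_def c1_def[symmetric] s1_def[symmetric] C_def[symmetric]
        by (simp add: algebra_simps power2_eq_square)
      finally show ?thesis .
    qed
    also have "c1 - C = - 2 * \<theta> * sn \<theta> ((\<tau> + t) / 2) * sn \<theta> ((\<tau> - t) / 2)"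
      unfolding c1_def C_def by (rule cs_diff_prod[OF \<theta>])
    finally have "\<theta> * h (c + cs \<theta> t *\<^sub>R w + sn \<theta> t *\<^sub>R L w) =
        \<theta> * (- 2 * sn \<theta> ((\<tau> + t) / 2) * sn \<theta> ((\<tau> - t) / 2) * arc_factor L \<theta> c w \<tau> t)"
      by (simp add: c1_def s1_def mult.assoc mult.left_commute)
    then show ?A using \<theta> by (metis mult_left_cancel)
  qed
  \<comment> \<open>As \<open>cs\<close> is even and \<open>sn\<close> is odd, the end points differ
    only in the sign of \<open>s\<close>, so one formula yields both remaining claims.\<close>
  have deriv: "2 * (L (c + C *\<^sub>R w + s *\<^sub>R L w - c) \<bullet> (c + C *\<^sub>R w + s *\<^sub>R L w)) =
      s * (\<theta> * (2 * (c \<bullet> w) + (C + C) * (w \<bullet> w)) + (C + C) * (L w \<bullet> L w) + 2 * \<theta> * s * (w \<bullet> L w))" for s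
  proof -
    have "L (c + C *\<^sub>R w + s *\<^sub>R L w - c) = C *\<^sub>R L w + (s * \<theta>) *\<^sub>R w"
      using lin LL by (simp add: linear_add linear_scale)
    then have "2 * (L (c + C *\<^sub>R w + s *\<^sub>R L w - c) \<bullet> (c + C *\<^sub>R w + s *\<^sub>R L w)) =
      2 * ((C *\<^sub>R L w + (s * \<theta>) *\<^sub>R w) \<bullet> (c + C *\<^sub>R w + s *\<^sub>R L w))" by simp
    also have "\<dots> = 2 * (C * (c \<bullet> L w) + C\<^sup>2 * (w \<bullet> L w) + C * s * (L w \<bullet> L w) + s * \<theta> * (c \<bullet> w) + s * \<theta> * C * (w \<bullet> w) + s\<^sup>2 * \<theta> * (w \<bullet> L w))"
      by (simp add: inner_add_left inner_add_right inner_commute power2_eq_square algebra_simps)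
    finally show ?thesis
      unfolding odd by (simp add: algebra_simps power2_eq_square)
  qed
  show ?B using deriv[of S] by (simp add: C_def S_def arc_factor_def)
  show ?C using deriv[of "- S"] by (simp add: C_def S_def arc_factor_def)
qed

text \<open>Inside the arc the sign is read off from \<open>h\<close> and the positive values of
  \<open>sn\<close>. At the two ends, where \<open>h\<close> vanishes, the strict crossing
  inequalities give it instead.\<close>

lemma arc_factor_sign:
  assumes L: "traceless_map L \<theta>" and arc: "arc_from L \<theta> c \<sigma> p q a"
    and p: "p = c + cs \<theta> (a/2) *\<^sub>R w - sn \<theta> (a/2) *\<^sub>R L w"
    and q: "q = c + cs \<theta> (a/2) *\<^sub>R w + sn \<theta> (a/2) *\<^sub>R L w"
    and t: "t \<in> {- (a/2)..a/2}"
  shows "\<sigma> * arc_factor L \<theta> c w (a/2) t < 0"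
proof -
  let ?\<tau> = "a/2" and ?K = "arc_factor L \<theta> c w (a/2)"
  have sn: "sn \<theta> ?\<tau> > 0" using arc_from_chord(2)[OF L arc] .
  note fac = arc_factorization[OF L, of "a/2" c w, folded p q]
  have pq: "h p = 0" "h q = 0" "sn \<theta> ?\<tau> \<noteq> 0" using arc sn by (auto simp: arc_from_def S1_iff_h)
  consider "t = ?\<tau>" | "t = - ?\<tau>" | "- ?\<tau> < t" "t < ?\<tau>" using t by fastforce
  then show ?thesis
  proof cases
    case 1
    have "\<sigma> * (sn \<theta> ?\<tau> * ?K ?\<tau>) = 2 * (\<sigma> * (L (q - c) \<bullet> q))"
      using fac(2)[OF pq(3,1,2)] by (metis mult.left_commute)
    also have "\<dots> < 0" using arc by (simp add: arc_from_def)
    finally have "sn \<theta> ?\<tau> * (\<sigma> * ?K ?\<tau>) < 0" by (simp add: mult.left_commute)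
    then show ?thesis unfolding 1 using sn by (simp add: mult_less_0_iff)
  next
    case 2
    have "\<sigma> * (sn \<theta> ?\<tau> * ?K (- ?\<tau>)) = - 2 * (\<sigma> * (L (p - c) \<bullet> p))"
      using fac(3)[OF pq(3,1,2)] by algebra
    also have "\<dots> < 0" using arc by (simp add: arc_from_def)
    finally have "sn \<theta> ?\<tau> * (\<sigma> * ?K (- ?\<tau>)) < 0" by (simp add: mult.left_commute)
    then show ?thesis unfolding 2 using sn by (simp add: mult_less_0_iff)
  next
    case 3
    have "sn \<theta> ((?\<tau> + t) / 2) > 0" "sn \<theta> ((?\<tau> - t) / 2) > 0"
      using 3 by (auto intro!: arc_from_sn_pos[OF L arc])
    moreover have "0 < \<sigma> * h (flow L \<theta> c (?\<tau> + t) p)"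
      using arc 3 by (auto simp: arc_from_def)
    then have "0 < \<sigma> * (- 2 * sn \<theta> ((?\<tau> + t) / 2) * sn \<theta> ((?\<tau> - t) / 2) * ?K t)"
      unfolding flow_centered[OF L p] fac(1)[OF pq(3,1,2)] .
    then have "(sn \<theta> ((?\<tau> + t) / 2) * sn \<theta> ((?\<tau> - t) / 2)) * (\<sigma> * ?K t) < 0"
      by (simp add: algebra_simps)
    ultimately show ?thesis by (simp add: mult_less_0_iff)
  qed
qed

section \<open>Perturbation of arcs\<close>

text \<open>The tube lemma: one neighbourhood of \<open>x0\<close> serves all parameters in the
  compact set \<open>R\<close> at once.\<close>

lemma eventually_compact_image_subset:
  fixes F :: "'a::topological_space \<times> 'b::topological_space \<Rightarrow> 'c::topological_space"
  assumes "continuous_on UNIV F" "open N" "compact R" "\<And>r. r \<in> R \<Longrightarrow> F (x0, r) \<in> N" "(x \<longlongrightarrow> x0) G"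
  shows "\<forall>\<^sub>F t in G. \<forall>r\<in>R. F (x t, r) \<in> N"
proof -
  have "open (F -` N)" using assms(1,2) by (simp add: open_vimage)
  moreover have "{x0} \<times> R \<subseteq> F -` N" using assms(4) by auto
  ultimately obtain X0 where X0: "x0 \<in> X0" "open X0" "X0 \<times> R \<subseteq> F -` N"
    using Elementary_Topology.tube_lemma[OF assms(3)] by metis
  have "\<forall>\<^sub>F t in G. x t \<in> X0"
    using assms(5) X0 by (simp add: topological_tendstoD)
  then show ?thesis
    by eventually_elim (use X0(3) in auto)
qed

text \<open>End points that move continuously and keep the chord relation remain joined by an arc:
  the multiplier determines the flight time, the half chord determines the middle position, and the
  strict sign of \<open>arc_factor\<close> keeps the new arc on its side.\<close>

lemma perturb_arc:
  fixes ps qs :: "real \<Rightarrow> plane" and \<kappa> :: "real \<Rightarrow> real"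
  assumes L: "traceless_map L \<theta>" and arc: "arc_from L \<theta> c \<sigma> p q a"
    and N: "open N" "\<And>s. s \<in> {0..a} \<Longrightarrow> flow L \<theta> c s p \<in> N"
    and cont: "isCont ps \<nu>" "isCont qs \<nu>" "isCont \<kappa> \<nu>" "ps \<nu> = p" "qs \<nu> = q"
    and ev: "\<forall>\<^sub>F t in nhds \<nu>. ps t \<in> S1 \<and> qs t \<in> S1 \<and>
      L ((1/2) *\<^sub>R (ps t + qs t) - c) = \<kappa> t *\<^sub>R ((1/2) *\<^sub>R (qs t - ps t))"
  shows "\<forall>\<^sub>F t in nhds \<nu>. \<exists>a'>0. flow L \<theta> c a' (ps t) = qs t \<and>
      (\<forall>s\<in>{0..a'}. 0 \<le> \<sigma> * h (flow L \<theta> c s (ps t)) \<and> flow L \<theta> c s (ps t) \<in> N)"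
proof -
  have \<theta>: "\<theta> \<noteq> 0" and lin: "linear L" and LL: "\<And>z. L (L z) = \<theta> *\<^sub>R z" and bl: "bounded_linear L"
    using traceless_mapD[OF L] by auto
  define \<tau> where "\<tau> = a / 2"
  have \<tau>: "\<tau> > 0" using arc by (simp add: \<tau>_def arc_from_def)
  obtain w where w: "p = c + cs \<theta> \<tau> *\<^sub>R w - sn \<theta> \<tau> *\<^sub>R L w"
    "q = c + cs \<theta> \<tau> *\<^sub>R w + sn \<theta> \<tau> *\<^sub>R L w"
    unfolding \<tau>_def using arc_from_centered[OF L arc] .
  have snpos: "sn \<theta> t > 0" if "0 < t" "t \<le> \<tau>" for t
    using arc_from_sn_pos[OF L arc, of t] that by (simp add: \<tau>_def)
  have sn: "sn \<theta> \<tau> > 0" using snpos \<tau> by simp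
  have chord: "(1/2) *\<^sub>R (q - p) = sn \<theta> \<tau> *\<^sub>R L w"
    unfolding w by (simp add: vec_eq_iff field_simps)
  have \<kappa>0: "\<kappa> \<nu> = cs \<theta> \<tau> / sn \<theta> \<tau>"
  proof -
    have "\<kappa> \<nu> *\<^sub>R ((1/2) *\<^sub>R (q - p)) = L ((1/2) *\<^sub>R (p + q) - c)"
      using eventually_nhds_x_imp_x[OF ev] cont(4,5) by simp
    also have "\<dots> = (cs \<theta> \<tau> / sn \<theta> \<tau>) *\<^sub>R ((1/2) *\<^sub>R (q - p))"
      using arc_from_chord(1)[OF L arc] by (simp add: \<tau>_def)
    finally show ?thesis using arc_from_neq[OF arc] by simp
  qed
  obtain T where T: "isCont T (\<kappa> \<nu>)" "T (\<kappa> \<nu>) = \<tau>"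
    "\<forall>\<^sub>F k in nhds (\<kappa> \<nu>). 0 < T k \<and> cs \<theta> (T k) = k * sn \<theta> (T k) \<and>
       (\<forall>t. 0 < t \<longrightarrow> t \<le> T k \<longrightarrow> sn \<theta> t > 0)"
    unfolding \<kappa>0 using half_time_inverse[OF \<theta> \<tau> snpos] by blast
  define Tn where "Tn t = T (\<kappa> t)" for t
  \<comment> \<open>The half chord is to be \<open>sn\<close> times \<open>L w\<close>; applying
    \<open>L\<close> once more and dividing by \<theta> recovers \<open>w\<close>.\<close>
  define W where "W t = (1 / (\<theta> * sn \<theta> (Tn t))) *\<^sub>R L ((1/2) *\<^sub>R (qs t - ps t))" for t
  have lim\<kappa>: "filterlim \<kappa> (nhds (\<kappa> \<nu>)) (nhds \<nu>)"
    using cont(3) isCont_def tendsto_at_iff_tendsto_nhds by blast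
  have limT: "(Tn \<longlongrightarrow> \<tau>) (nhds \<nu>)"
    unfolding Tn_def using isCont_tendsto_compose[OF T(1) lim\<kappa>] T(2) by simp
  have limsn: "((\<lambda>t. sn \<theta> (Tn t)) \<longlongrightarrow> sn \<theta> \<tau>) (nhds \<nu>)"
    by (rule isCont_tendsto_compose[OF _ limT]) (rule DERIV_isCont[OF sn_has_derivative[OF \<theta>]])
  have lime: "((\<lambda>t. (1/2) *\<^sub>R (qs t - ps t)) \<longlongrightarrow> (1/2) *\<^sub>R (q - p)) (nhds \<nu>)"
    using cont(1,2,4,5) by (intro tendsto_intros) (auto simp: isCont_def tendsto_at_iff_tendsto_nhds)
  have "(W \<longlongrightarrow> (1 / (\<theta> * sn \<theta> \<tau>)) *\<^sub>R L ((1/2) *\<^sub>R (q - p))) (nhds \<nu>)"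
    unfolding W_def using \<theta> sn
    by (intro tendsto_intros limsn bounded_linear.tendsto[OF bl] lime) auto
  moreover have "(1 / (\<theta> * sn \<theta> \<tau>)) *\<^sub>R L ((1/2) *\<^sub>R (q - p)) = w"
    unfolding chord using \<theta> sn LL lin by (simp add: linear_scale)
  ultimately have limW: "(W \<longlongrightarrow> w) (nhds \<nu>)" by simp
  have lim: "((\<lambda>t. (W t, Tn t)) \<longlongrightarrow> (w, \<tau>)) (nhds \<nu>)"
    using limW limT by (rule tendsto_Pair)
  \<comment> \<open>The flight time varies with \<open>t\<close>, so time is rescaled to
    \<open>r\<close> between -1 and 1 to obtain a fixed compact set.\<close>
  let ?F = "\<lambda>((w, \<tau>), r). c + cs \<theta> (\<tau> * r) *\<^sub>R w + sn \<theta> (\<tau> * r) *\<^sub>R L w"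
  let ?K = "\<lambda>((w, \<tau>), r). \<sigma> * arc_factor L \<theta> c w \<tau> (\<tau> * r)"
  have contF: "continuous_on UNIV ?F"
    using \<theta> unfolding case_prod_unfold
    by (intro continuous_intros linear_continuous_on_compose[OF _ lin]) auto
  have contK: "continuous_on UNIV ?K"
    using \<theta> unfolding case_prod_unfold arc_factor_def
    by (intro continuous_intros linear_continuous_on_compose[OF _ lin]) auto
  have scale: "\<tau> * r \<in> {- \<tau>..\<tau>}" if "r \<in> {-1..1}" for r
    using that \<tau> mult_left_mono[of r 1 \<tau>] mult_left_mono[of "- 1" r \<tau>] by auto
  have evF: "\<forall>\<^sub>F t in nhds \<nu>. \<forall>r\<in>{-1..1}. ?F ((W t, Tn t), r) \<in> N"
  proof (rule eventually_compact_image_subset[OF contF N(1) _ _ lim])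
    fix r :: real assume r: "r \<in> {-1..1}"
    have "\<tau> * r \<in> {- \<tau>..\<tau>}" using scale[OF r] .
    then have "\<tau> + \<tau> * r \<in> {0..a}" by (auto simp: \<tau>_def)
    then have "flow L \<theta> c (\<tau> + \<tau> * r) p \<in> N" using N(2) by auto
    then show "?F ((w, \<tau>), r) \<in> N" by (simp add: flow_centered[OF L w(1)])
  qed simp
  have evK: "\<forall>\<^sub>F t in nhds \<nu>. \<forall>r\<in>{-1..1}. ?K ((W t, Tn t), r) \<in> {..<0}"
  proof (rule eventually_compact_image_subset[OF contK open_lessThan _ _ lim])
    fix r :: real assume r: "r \<in> {-1..1}"
    have "\<tau> * r \<in> {- \<tau>..\<tau>}" using scale[OF r] .
    then show "?K ((w, \<tau>), r) \<in> {..<0}"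
      using arc_factor_sign[OF L arc, of w "\<tau> * r"] w by (simp add: \<tau>_def)
  qed simp
  have evT: "\<forall>\<^sub>F t in nhds \<nu>. 0 < Tn t \<and> cs \<theta> (Tn t) = \<kappa> t * sn \<theta> (Tn t) \<and>
       (\<forall>s. 0 < s \<longrightarrow> s \<le> Tn t \<longrightarrow> sn \<theta> s > 0)"
    unfolding Tn_def using filterlim_iff[THEN iffD1, OF lim\<kappa>] T(3) by blast
  from evF evK evT ev show ?thesis
  proof eventually_elim
    case (elim t)
    let ?w = "W t" and ?\<tau> = "Tn t"
    have \<tau>': "?\<tau> > 0" and snp: "\<And>s. 0 < s \<Longrightarrow> s \<le> ?\<tau> \<Longrightarrow> sn \<theta> s > 0" using elim by auto
    have sn': "sn \<theta> ?\<tau> > 0" using \<tau>' snp by simp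
    have e: "sn \<theta> ?\<tau> *\<^sub>R L ?w = (1/2) *\<^sub>R (qs t - ps t)"
      using sn' \<theta> lin LL by (simp add: W_def linear_scale)
    have "L (cs \<theta> ?\<tau> *\<^sub>R ?w) = L ((1/2) *\<^sub>R (ps t + qs t) - c)"
    proof -
      have "L (cs \<theta> ?\<tau> *\<^sub>R ?w) = \<kappa> t *\<^sub>R (sn \<theta> ?\<tau> *\<^sub>R L ?w)"
        using elim lin by (simp add: linear_scale)
      then show ?thesis unfolding e using elim by simp
    qed
    \<comment> \<open>\<open>L\<close> is cancelled by applying it again and dividing by
      \<theta>.\<close>
    then have "L (L (cs \<theta> ?\<tau> *\<^sub>R ?w)) = L (L ((1/2) *\<^sub>R (ps t + qs t) - c))" by simp
    then have m: "cs \<theta> ?\<tau> *\<^sub>R ?w = (1/2) *\<^sub>R (ps t + qs t) - c"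
      using \<theta> unfolding LL by (simp only: scaleR_cancel_left) simp
    have p: "ps t = c + cs \<theta> ?\<tau> *\<^sub>R ?w - sn \<theta> ?\<tau> *\<^sub>R L ?w"
      unfolding e m by (simp add: vec_eq_iff field_simps)
    have q: "qs t = c + cs \<theta> ?\<tau> *\<^sub>R ?w + sn \<theta> ?\<tau> *\<^sub>R L ?w"
      unfolding e m by (simp add: vec_eq_iff field_simps)
    have hp: "h (ps t) = 0" "h (qs t) = 0" using elim by (auto simp: S1_iff_h)
    note fac = arc_factorization(1)[OF L, of ?\<tau> c ?w, folded p q]
    show ?case
    proof (intro exI[of _ "2 * ?\<tau>"] conjI ballI)
      show "0 < 2 * ?\<tau>" using \<tau>' by simp
      show "flow L \<theta> c (2 * ?\<tau>) (ps t) = qs t"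
        using flow_centered[OF L p, of ?\<tau>] q by simp
      fix s assume s: "s \<in> {0..2 * ?\<tau>}"
      define u where "u = s - ?\<tau>"
      have u: "u \<in> {- ?\<tau>..?\<tau>}" "s = ?\<tau> + u" using s by (auto simp: u_def)
      have r: "u / ?\<tau> \<in> {-1..1}" "?\<tau> * (u / ?\<tau>) = u"
        using u \<tau>' by (auto simp: field_simps)
      have fl: "flow L \<theta> c s (ps t) = c + cs \<theta> u *\<^sub>R ?w + sn \<theta> u *\<^sub>R L ?w"
        unfolding u(2) by (rule flow_centered[OF L p])
      show "flow L \<theta> c s (ps t) \<in> N"
        using bspec[OF elim(1) r(1)] r(2) by (simp add: fl)
      have K: "\<sigma> * arc_factor L \<theta> c ?w ?\<tau> u < 0"
        using bspec[OF elim(2) r(1)] r(2) by simp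
      have "sn \<theta> ((?\<tau> + u) / 2) \<ge> 0" "sn \<theta> ((?\<tau> - u) / 2) \<ge> 0"
        using u(1) snp[of "(?\<tau> + u) / 2"] snp[of "(?\<tau> - u) / 2"]
        by (cases "?\<tau> + u = 0"; force)+
      then have "(sn \<theta> ((?\<tau> + u) / 2) * sn \<theta> ((?\<tau> - u) / 2)) * (- (\<sigma> * arc_factor L \<theta> c ?w ?\<tau> u)) \<ge> 0"
        using K by (intro mult_nonneg_nonneg) auto
      then show "0 \<le> \<sigma> * h (flow L \<theta> c s (ps t))"
        unfolding fl using fac[OF _ hp, of u] sn' by (simp add: algebra_simps)
    qed
  qed
qed

section \<open>Gluing two arcs into a Filippov periodic orbit\<close>

lemma periodic_orbit_two_arcs:
  assumes L1: "traceless_map L1 \<theta>1" and L2: "traceless_map L2 \<theta>2"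
    and ab: "0 < a" "0 < b" and pq: "p \<noteq> q" "flow L2 \<theta>2 c2 b p = q" "flow L1 \<theta>1 c1 a q = p"
    and outer: "\<And>s. s \<in> {0..b} \<Longrightarrow> 0 \<le> h (flow L2 \<theta>2 c2 s p) \<and> flow L2 \<theta>2 c2 s p \<in> U"
    and inner: "\<And>s. s \<in> {0..a} \<Longrightarrow> h (flow L1 \<theta>1 c1 s q) \<le> 0 \<and> flow L1 \<theta>1 c1 s q \<in> U"
  shows "periodic_orbit (\<lambda>z. L1 (z - c1)) (\<lambda>z. L2 (z - c2)) U
    ((\<lambda>t. flow L2 \<theta>2 c2 t p) ` {0..b} \<union> (\<lambda>t. flow L1 \<theta>1 c1 t q) ` {0..a})"
proof -
  let ?X = "\<lambda>z. L1 (z - c1)" and ?Y = "\<lambda>z. L2 (z - c2)"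
  let ?f2 = "\<lambda>t. flow L2 \<theta>2 c2 t p" and ?f1 = "\<lambda>t. flow L1 \<theta>1 c1 t q"
  define \<gamma> where "\<gamma> t = (if t \<le> b then ?f2 t else ?f1 (t - b))" for t
  define v where "v t = (if t \<le> b then ?Y (\<gamma> t) else ?X (\<gamma> t))" for t
  have img: "\<gamma> ` {0..a + b} = ?f2 ` {0..b} \<union> ?f1 ` {0..a}"
  proof (intro equalityI subsetI)
    fix z assume "z \<in> ?f2 ` {0..b} \<union> ?f1 ` {0..a}"
    then consider s where "s \<in> {0..b}" "z = ?f2 s" | s where "s \<in> {0..a}" "z = ?f1 s" by auto
    then show "z \<in> \<gamma> ` {0..a + b}"
    proof cases
      case 1 then show ?thesis using ab by (auto simp: \<gamma>_def intro!: image_eqI[of _ _ s])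
    next
      case 2
      then have "z = \<gamma> (b + s)" using pq by (auto simp: \<gamma>_def)
      then show ?thesis using 2 ab by auto
    qed
  qed (use ab in \<open>auto simp: \<gamma>_def\<close>)
  have int2: "(v has_integral (\<gamma> t - \<gamma> 0)) {0..t}" if "t \<in> {0..b}" for t
  proof -
    have "((\<lambda>s. ?Y (?f2 s)) has_integral (?f2 t - ?f2 0)) {0..t}"
      using that by (intro fundamental_theorem_of_calculus flow_has_vector_derivative[OF L2]) auto
    then have "(v has_integral (?f2 t - ?f2 0)) {0..t}"
      by (rule has_integral_eq[rotated]) (use that in \<open>auto simp: v_def \<gamma>_def\<close>)
    then show ?thesis using that by (simp add: \<gamma>_def)
  qed
  have int1: "(v has_integral (\<gamma> t - \<gamma> b)) {b..t}" if "t \<in> {b..a + b}" for t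
  proof -
    have "((\<lambda>s. ?f1 (s - b)) has_vector_derivative ?X (?f1 (s - b))) (at s within {b..t})" for s
      \<comment> \<open>Starting the inner flow time \<open>b\<close> before \<open>q\<close>
        absorbs the time shift into the base point.\<close>
      using flow_has_vector_derivative[OF L1, of c1 "flow L1 \<theta>1 c1 (- b) q"]
      by (simp add: flow_add[OF L1])
    then have "((\<lambda>s. ?X (?f1 (s - b))) has_integral (?f1 (t - b) - ?f1 (b - b))) {b..t}"
      using that by (intro fundamental_theorem_of_calculus) auto
    then have "(v has_integral (?f1 (t - b) - ?f1 (b - b))) {b..t}"
      \<comment> \<open>At the junction time \<open>b\<close> the density takes the outer value; a
        single point does not affect the integral.\<close>
      by (rule has_integral_spike_finite[of "{b}", rotated 2]) (use that in \<open>auto simp: v_def \<gamma>_def\<close>)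
    then show ?thesis using that pq ab by (auto simp: \<gamma>_def split: if_splits)
  qed
  have "trajectory_on ?X ?Y U \<gamma> (a + b)"
    unfolding trajectory_on_def
  proof (intro conjI exI[of _ v] ballI)
    show "\<gamma> ` {0..a + b} \<subseteq> U" unfolding img using outer inner by auto
    fix t assume t: "t \<in> {0..a + b}"
    show "v t \<in> filippov ?X ?Y (\<gamma> t)"
    proof (cases "t \<le> b")
      case True
      then have "0 \<le> h (\<gamma> t)" "v t = ?Y (\<gamma> t)" using outer[of t] t by (auto simp: \<gamma>_def v_def)
      then show ?thesis by (auto simp: filippov_def)
    next
      case False
      then have "h (\<gamma> t) \<le> 0" "v t = ?X (\<gamma> t)" using inner[of "t - b"] t by (auto simp: \<gamma>_def v_def)
      then show ?thesis by (auto simp: filippov_def)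
    qed
    show "(v has_integral (\<gamma> t - \<gamma> 0)) {0..t}"
    proof (cases "t \<le> b")
      case True
      then show ?thesis using int2 t by auto
    next
      case False
      then show ?thesis
        using has_integral_combine[OF _ _ int2[of b] int1[of t]] t ab by simp
    qed
  qed
  moreover have "\<gamma> (a + b) = \<gamma> 0" using pq ab by (simp add: \<gamma>_def)
  moreover have "\<gamma> b \<noteq> \<gamma> 0" using pq ab by (simp add: \<gamma>_def)
  ultimately have "closed_trajectory ?X ?Y U \<gamma> (a + b)"
    unfolding closed_trajectory_def using ab by force
  then show ?thesis
    unfolding periodic_orbit_def using img by metis
qed

section \<open>The two arcs of a crossing periodic orbit\<close>

text \<open>A one-sided, local form of being a concatenation of arcs; in contrast to the partition it
  passes to the periodic extension.\<close>

definition arc_side :: "vfield \<Rightarrow> vfield \<Rightarrow> (real \<Rightarrow> plane) \<Rightarrow> real \<Rightarrow> real filter \<Rightarrow> bool" where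
  "arc_side X Y \<gamma> t F \<longleftrightarrow>
     ((\<forall>\<^sub>F s in F. h (\<gamma> s) \<le> 0) \<and> (\<gamma> has_vector_derivative X (\<gamma> t)) F) \<or>
     ((\<forall>\<^sub>F s in F. h (\<gamma> s) \<ge> 0) \<and> (\<gamma> has_vector_derivative Y (\<gamma> t)) F)"

lemma arc_side_right:
  assumes "inner_arc X \<gamma> a b \<or> outer_arc Y \<gamma> a b" "a \<le> t" "t < b"
  shows "arc_side X Y \<gamma> t (at_right t)"
proof -
  have F: "at t within {t..b} = at_right t"
    using assms by (simp add: at_within_Icc_at_right)
  have ev: "\<forall>\<^sub>F s in at_right t. s \<in> {a..b}"
    using assms by (auto simp: eventually_at_right intro!: exI[of _ b])
  have sub: "(\<gamma> has_vector_derivative D) (at_right t)"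
    if "(\<gamma> has_vector_derivative D) (at t within {a..b})" for D
    using has_vector_derivative_within_subset[OF that, of "{t..b}"] assms(2) F by auto
  from assms(1) show ?thesis
  proof
    assume *: "inner_arc X \<gamma> a b"
    then have "\<forall>\<^sub>F s in at_right t. h (\<gamma> s) \<le> 0"
      using ev by (auto simp: inner_arc_def elim!: eventually_mono)
    then show ?thesis
      using * sub assms by (auto simp: arc_side_def inner_arc_def)
  next
    assume *: "outer_arc Y \<gamma> a b"
    then have "\<forall>\<^sub>F s in at_right t. h (\<gamma> s) \<ge> 0"
      using ev by (auto simp: outer_arc_def elim!: eventually_mono)
    then show ?thesis
      using * sub assms by (auto simp: arc_side_def outer_arc_def)
  qed
qed

lemma arc_side_left:
  assumes "inner_arc X \<gamma> a b \<or> outer_arc Y \<gamma> a b" "a < t" "t \<le> b"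
  shows "arc_side X Y \<gamma> t (at_left t)"
proof -
  have F: "at t within {a..t} = at_left t"
    using assms by (simp add: at_within_Icc_at_left)
  have ev: "\<forall>\<^sub>F s in at_left t. s \<in> {a..b}"
    using assms by (auto simp: eventually_at_left intro!: exI[of _ a])
  have sub: "(\<gamma> has_vector_derivative D) (at_left t)"
    if "(\<gamma> has_vector_derivative D) (at t within {a..b})" for D
    using has_vector_derivative_within_subset[OF that, of "{a..t}"] assms(3) F by auto
  from assms(1) show ?thesis
  proof
    assume *: "inner_arc X \<gamma> a b"
    then have "\<forall>\<^sub>F s in at_left t. h (\<gamma> s) \<le> 0"
      using ev by (auto simp: inner_arc_def elim!: eventually_mono)
    then show ?thesis
      using * sub assms by (auto simp: arc_side_def inner_arc_def)
  next
    assume *: "outer_arc Y \<gamma> a b"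
    then have "\<forall>\<^sub>F s in at_left t. h (\<gamma> s) \<ge> 0"
      using ev by (auto simp: outer_arc_def elim!: eventually_mono)
    then show ?thesis
      using * sub assms by (auto simp: arc_side_def outer_arc_def)
  qed
qed

lemma partition_index_right:
  fixes \<tau> :: "nat \<Rightarrow> real"
  assumes "\<tau> 0 \<le> t" "t < \<tau> n"
  obtains i where "i < n" "\<tau> i \<le> t" "t < \<tau> (Suc i)"
proof -
  define k where "k = (LEAST k. t < \<tau> k)"
  have k: "t < \<tau> k" "k \<le> n" unfolding k_def using assms(2) by (auto intro: LeastI Least_le)
  then obtain i where i: "k = Suc i" using assms(1) by (cases k) auto
  have "\<not> t < \<tau> i" using not_less_Least[of i "\<lambda>k. t < \<tau> k"] i by (simp add: k_def)
  then show ?thesis using that[of i] k i by auto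
qed

lemma partition_index_left:
  fixes \<tau> :: "nat \<Rightarrow> real"
  assumes "\<tau> 0 < t" "t \<le> \<tau> n"
  obtains i where "i < n" "\<tau> i < t" "t \<le> \<tau> (Suc i)"
proof -
  define k where "k = (LEAST k. t \<le> \<tau> k)"
  have k: "t \<le> \<tau> k" "k \<le> n" unfolding k_def using assms(2) by (auto intro: LeastI Least_le)
  then obtain i where i: "k = Suc i" using assms(1) by (cases k) auto
  have "\<not> t \<le> \<tau> i" using not_less_Least[of i "\<lambda>k. t \<le> \<tau> k"] i by (simp add: k_def)
  then show ?thesis using that[of i] k i by auto
qed

lemma concatenation_arc_side:
  assumes "concatenation_of_arcs X Y \<gamma> T"
  shows "0 \<le> t \<Longrightarrow> t < T \<Longrightarrow> arc_side X Y \<gamma> t (at_right t)"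
    and "0 < t \<Longrightarrow> t \<le> T \<Longrightarrow> arc_side X Y \<gamma> t (at_left t)"
proof -
  obtain n and \<tau> :: "nat \<Rightarrow> real" where \<tau>: "\<tau> 0 = 0" "\<tau> n = T"
    "\<And>i. i < n \<Longrightarrow> inner_arc X \<gamma> (\<tau> i) (\<tau> (Suc i)) \<or> outer_arc Y \<gamma> (\<tau> i) (\<tau> (Suc i))"
    using assms unfolding concatenation_of_arcs_def by metis
  show "arc_side X Y \<gamma> t (at_right t)" if "0 \<le> t" "t < T"
    using partition_index_right[of \<tau> t n] \<tau> arc_side_right that by metis
  show "arc_side X Y \<gamma> t (at_left t)" if "0 < t" "t \<le> T"
    using partition_index_left[of \<tau> t n] \<tau> arc_side_left that by metis
qed

lemma arc_side_shift:
  assumes "arc_side X Y \<gamma> (t - d) (at (t - d) within S)" "\<gamma>' t = \<gamma> (t - d)"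
    and "\<forall>\<^sub>F s in at t within ((+) d ` S). \<gamma>' s = \<gamma> (s - d)"
  shows "arc_side X Y \<gamma>' t (at t within ((+) d ` S))"
proof -
  let ?F = "at t within ((+) d ` S)"
  have img: "(\<lambda>s. s - d) ` (+) d ` S = S" by (auto simp: image_iff)
  have lim: "filterlim (\<lambda>s. s - d) (at (t - d) within S) ?F"
    unfolding filterlim_at by (auto intro!: tendsto_intros always_eventually simp: eventually_at_filter)
  have ev: "\<forall>\<^sub>F s in ?F. P (\<gamma>' s)" if "\<forall>\<^sub>F s in at (t - d) within S. P (\<gamma> s)" for P
    using filterlim_iff[THEN iffD1, OF lim, rule_format, OF that] assms(3)
    by eventually_elim simp
  have der: "(\<gamma>' has_vector_derivative D) ?F"
    if D: "(\<gamma> has_vector_derivative D) (at (t - d) within S)" for D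
  proof -
    have "((\<lambda>s. s - d) has_vector_derivative 1) ?F"
      by (auto intro!: derivative_eq_intros)
    then have "(\<gamma> \<circ> (\<lambda>s. s - d) has_vector_derivative 1 *\<^sub>R D) ?F"
      using D img by (intro vector_diff_chain_within) auto
    then have "((\<lambda>s. \<gamma> (s - d)) has_vector_derivative D) ?F" by (simp add: o_def)
    moreover have "((\<lambda>s. (1 / norm (s - t)) *\<^sub>R (\<gamma>' s - (\<gamma> (t - d) + (s - t) *\<^sub>R D))) \<longlongrightarrow> 0) ?F \<longleftrightarrow>
        ((\<lambda>s. (1 / norm (s - t)) *\<^sub>R (\<gamma> (s - d) - (\<gamma> (t - d) + (s - t) *\<^sub>R D))) \<longlongrightarrow> 0) ?F"
      by (rule tendsto_cong) (use assms(3) in eventually_elim, simp)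
    ultimately show ?thesis
      unfolding has_vector_derivative_def has_derivative_within assms(2) by simp
  qed
  show ?thesis
    using assms(1) ev[of "\<lambda>z. h z \<le> 0"] ev[of "\<lambda>z. h z \<ge> 0"] der
    unfolding arc_side_def assms(2) by blast
qed

text \<open>On the whole line the starting point loses its special role: it may lie inside an arc,
  and every time has both a left and a right side. At multiples of \<open>T\<close> these sides come
  from opposite ends of the original interval.\<close>

lemma periodic_extension:
  assumes cat: "concatenation_of_arcs X Y \<gamma> T" and T: "0 < T" "\<gamma> T = \<gamma> 0"
  obtains \<gamma>' where "\<And>t. \<gamma>' (t + T) = \<gamma>' t" "\<gamma> ` {0..T} = range \<gamma>'"
    "\<And>t. arc_side X Y \<gamma>' t (at_right t)" "\<And>t. arc_side X Y \<gamma>' t (at_left t)"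
proof -
  define d where "d t = T * of_int \<lfloor>t / T\<rfloor>" for t
  define \<gamma>' where "\<gamma>' t = \<gamma> (t - d t)" for t
  have range: "0 \<le> t - d t" "t - d t < T" for t
  proof -
    have "of_int \<lfloor>t / T\<rfloor> \<le> t / T" "t / T < of_int \<lfloor>t / T\<rfloor> + 1" by linarith+
    then have "T * of_int \<lfloor>t / T\<rfloor> \<le> T * (t / T)" "T * (t / T) < T * (of_int \<lfloor>t / T\<rfloor> + 1)"
      using T by (intro mult_left_mono mult_strict_left_mono; simp)+
    then show "0 \<le> t - d t" "t - d t < T" using T by (simp_all add: d_def algebra_simps)
  qed
  \<comment> \<open>Rounding down never produces the right end of the interval;
    \<open>\<gamma> T = \<gamma> 0\<close> makes the formula valid there too, as left-sided
    neighbourhoods require.\<close>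
  have eq: "\<gamma>' s = \<gamma> (s - T * of_int k)" if "s - T * of_int k \<in> {0..T}" for s k
  proof (cases "s - T * of_int k = T")
    case True
    then have "s / T = of_int (k + 1)" using T by (simp add: field_simps)
    then have "d s = T * of_int (k + 1)" by (simp only: d_def floor_of_int)
    then have "s - d s = 0" using True by (simp add: algebra_simps)
    then show ?thesis using True T by (simp add: \<gamma>'_def)
  next
    case False
    then have "\<lfloor>s / T\<rfloor> = k"
      using that T by (intro floor_unique) (auto simp: field_simps)
    then show ?thesis by (simp add: \<gamma>'_def d_def)
  qed
  have per: "\<gamma>' (t + T) = \<gamma>' t" for t
    using T by (simp add: \<gamma>'_def d_def add_divide_distrib algebra_simps)
  have img: "\<gamma> ` {0..T} = range \<gamma>'"
  proof (intro equalityI subsetI)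
    fix z assume "z \<in> \<gamma> ` {0..T}"
    then obtain t where "t \<in> {0..T}" "z = \<gamma> t" by auto
    then have "z = \<gamma>' t" using eq[of t 0] by simp
    then show "z \<in> range \<gamma>'" by simp
  qed (use range in \<open>auto simp: \<gamma>'_def less_imp_le\<close>)
  have right: "arc_side X Y \<gamma>' t (at_right t)" for t
  proof -
    have S: "(+) (d t) ` {t - d t<..} = {t<..}"
      by (auto simp: image_iff intro!: bexI[of _ "_ - d t"])
    have "\<forall>\<^sub>F s in at_right t. \<gamma>' s = \<gamma> (s - d t)"
    proof -
      have "\<forall>\<^sub>F s in at_right t. s \<in> {t<..<d t + T}"
        using range[of t] by (intro eventually_at_right_real) auto
      then show ?thesis
        by eventually_elim (use range[of t] eq in \<open>auto simp: d_def\<close>)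
    qed
    then show ?thesis
      using arc_side_shift[of X Y \<gamma> t "d t" "{t - d t<..}" \<gamma>'] concatenation_arc_side(1)[OF cat range]
      unfolding S by (simp add: \<gamma>'_def)
  qed
  have left: "arc_side X Y \<gamma>' t (at_left t)" for t
  proof -
    \<comment> \<open>This choice places \<open>t - T * of_int k\<close> in the interval open at 0
      and closed at \<open>T\<close>, so that points slightly to the left of \<open>t\<close> use
      the same translate.\<close>
    define k where "k = \<lceil>t / T\<rceil> - 1"
    define e where "e = T * of_int k"
    have "of_int k < t / T" "t / T \<le> of_int k + 1" unfolding k_def by linarith+
    then have e: "0 < t - e" "t - e \<le> T" using T by (simp_all add: e_def field_simps)
    have S: "(+) e ` {..<t - e} = {..<t}"
      by (auto simp: image_iff intro!: bexI[of _ "_ - e"])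
    have "\<forall>\<^sub>F s in at_left t. \<gamma>' s = \<gamma> (s - e)"
    proof -
      have "\<forall>\<^sub>F s in at_left t. s \<in> {e<..<t}"
        using e by (intro eventually_at_left_real) auto
      then show ?thesis
        by eventually_elim (use e eq[of _ k] in \<open>auto simp: e_def\<close>)
    qed
    then show ?thesis
      using arc_side_shift[of X Y \<gamma> t e "{..<t - e}" \<gamma>'] concatenation_arc_side(2)[OF cat e] eq[of t k] e
      unfolding S by (simp add: e_def)
  qed
  show ?thesis using that per img right left by blast
qed

section \<open>First and last zeros, and the sign of \<open>h\<close> near a crossing\<close>

lemma first_zero:
  fixes g :: "real \<Rightarrow> real"
  assumes "continuous_on {t..z} g" "t \<le> z" "0 < g t" "g z \<le> 0"
  obtains b where "t < b" "b \<le> z" "g b = 0" "\<And>s. t \<le> s \<Longrightarrow> s < b \<Longrightarrow> 0 < g s"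
proof -
  let ?Z = "{s \<in> {t..z}. g s \<le> 0}"
  have "closed ?Z"
    using continuous_closed_preimage[OF assms(1) closed_atLeastAtMost closed_atMost[of 0]]
    by (simp add: vimage_def Int_def)
  then have "compact ?Z"
    using bounded_subset[OF bounded_closed_interval[of t z], of ?Z] by (simp add: compact_eq_bounded_closed subset_iff)
  moreover have "?Z \<noteq> {}" using assms by auto
  ultimately have "\<exists>b\<in>?Z. \<forall>s\<in>?Z. b \<le> s" by (rule compact_attains_inf)
  then obtain b where b: "b \<in> ?Z" "\<And>s. s \<in> ?Z \<Longrightarrow> b \<le> s" by blast
  have b': "t \<le> b" "b \<le> z" "g b \<le> 0" using b(1) by auto
  have "continuous_on {t..b} g"
    using continuous_on_subset[OF assms(1), of "{t..b}"] b' by auto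
  then obtain x where x: "t \<le> x" "x \<le> b" "g x = 0"
    using IVT2'[of g b 0 t] assms(3) b' by auto
  have "x \<in> ?Z" using x b' by auto
  then have "x = b" using b(2)[of x] x by simp
  then have gb: "g b = 0" using x by simp
  then have "t \<noteq> b" using assms(3) by auto
  show ?thesis
  proof (rule that[of b])
    show "0 < g s" if "t \<le> s" "s < b" for s
    proof (rule ccontr)
      assume "\<not> 0 < g s"
      then have "s \<in> ?Z" using that b' by auto
      then show False using b(2)[of s] that by simp
    qed
  qed (use gb b' \<open>t \<noteq> b\<close> in auto)
qed

lemma last_zero:
  fixes g :: "real \<Rightarrow> real"
  assumes "continuous_on {z..t} g" "z \<le> t" "0 < g t" "g z \<le> 0"
  obtains b where "z \<le> b" "b < t" "g b = 0" "\<And>s. b < s \<Longrightarrow> s \<le> t \<Longrightarrow> 0 < g s"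
proof -
  have cont: "continuous_on {- t..- z} (\<lambda>s. g (- s))"
    by (rule continuous_on_compose2[OF assms(1)]) (auto intro!: continuous_intros)
  obtain b where
    b: "- t < b" "b \<le> - z" "g (- b) = 0" "\<And>s. - t \<le> s \<Longrightarrow> s < b \<Longrightarrow> 0 < g (- s)"
    by (rule first_zero[OF cont]) (use assms in auto)
  have "0 < g s" if "- b < s" "s \<le> t" for s
    using b(4)[of "- s"] that by simp
  with b show ?thesis by (intro that[of "- b"]) auto
qed

lemma arc_side_isCont:
  assumes "arc_side X Y \<gamma> t (at_left t)" "arc_side X Y \<gamma> t (at_right t)"
  shows "isCont \<gamma> t"
  using assms
  by (auto simp: arc_side_def continuous_at_split has_vector_derivative_def dest: has_derivative_continuous)

text \<open>At a crossing point both fields push \<open>h\<close> in the same direction, so the sign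
  of the one-sided derivative is independent of which field the curve follows.\<close>

lemma arc_side_h_derivative:
  assumes "arc_side X Y \<gamma> t (at t within S)" "0 < \<sigma> * lie_h X (\<gamma> t)" "0 < \<sigma> * lie_h Y (\<gamma> t)"
  obtains l where "0 < l" "((\<lambda>s. \<sigma> * h (\<gamma> s)) has_real_derivative l) (at t within S)"
proof -
  have "((\<lambda>s. \<sigma> * h (\<gamma> s)) has_real_derivative \<sigma> * (D \<bullet> grad_h (\<gamma> t))) (at t within S)"
    if "(\<gamma> has_vector_derivative D) (at t within S)" for D
  proof -
    have "((\<lambda>s. h (\<gamma> s)) has_derivative (\<lambda>s. (s *\<^sub>R D) \<bullet> grad_h (\<gamma> t))) (at t within S)"
      using has_derivative_compose[OF that[unfolded has_vector_derivative_def]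
          GDERIV_h[of "\<gamma> t", unfolded gderiv_def]] by (simp add: inner_commute)
    then have "((\<lambda>s. h (\<gamma> s)) has_real_derivative D \<bullet> grad_h (\<gamma> t)) (at t within S)"
      by (simp add: has_field_derivative_def mult_commute_abs)
    then show ?thesis by (rule DERIV_cmult)
  qed
  then show ?thesis
    using assms that unfolding arc_side_def lie_h_def by blast
qed

lemma h_sign_right:
  assumes "arc_side X Y \<gamma> t (at_right t)" "h (\<gamma> t) = 0"
    "0 < \<sigma> * lie_h X (\<gamma> t)" "0 < \<sigma> * lie_h Y (\<gamma> t)"
  shows "\<forall>\<^sub>F s in at_right t. 0 < \<sigma> * h (\<gamma> s)"
proof -
  obtain l where "0 < l" "((\<lambda>s. \<sigma> * h (\<gamma> s)) has_real_derivative l) (at_right t)"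
    using arc_side_h_derivative[OF assms(1,3,4)] .
  then obtain d where d: "d > 0" "\<And>e. 0 < e \<Longrightarrow> t + e \<in> {t<..} \<Longrightarrow> e < d \<Longrightarrow> 0 < \<sigma> * h (\<gamma> (t + e))"
    using has_real_derivative_pos_inc_right[of "\<lambda>s. \<sigma> * h (\<gamma> s)" l t "{t<..}"] assms(2) by auto
  then have "0 < \<sigma> * h (\<gamma> s)" if "t < s" "s < t + d" for s
    using d(2)[of "s - t"] that by simp
  then show ?thesis
    using d(1) by (auto simp: eventually_at_right_field intro!: exI[of _ "t + d"])
qed

lemma h_sign_left:
  assumes "arc_side X Y \<gamma> t (at_left t)" "h (\<gamma> t) = 0"
    "0 < \<sigma> * lie_h X (\<gamma> t)" "0 < \<sigma> * lie_h Y (\<gamma> t)"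
  shows "\<forall>\<^sub>F s in at_left t. \<sigma> * h (\<gamma> s) < 0"
proof -
  obtain l where "0 < l" "((\<lambda>s. \<sigma> * h (\<gamma> s)) has_real_derivative l) (at_left t)"
    using arc_side_h_derivative[OF assms(1,3,4)] .
  then obtain d where d: "d > 0" "\<And>e. 0 < e \<Longrightarrow> t - e \<in> {..<t} \<Longrightarrow> e < d \<Longrightarrow> \<sigma> * h (\<gamma> (t - e)) < 0"
    using has_real_derivative_pos_inc_left[of "\<lambda>s. \<sigma> * h (\<gamma> s)" l t "{..<t}"] assms(2) by auto
  then have "\<sigma> * h (\<gamma> s) < 0" if "s < t" "t - d < s" for s
    using d(2)[of "t - s"] that by simp
  then show ?thesis
    using d(1) by (auto simp: eventually_at_left_field intro!: exI[of _ "t - d"])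
qed

text \<open>A strict sign of \<open>h\<close> on a nontrivial filter excludes the alternative of
  \<open>arc_side\<close> that belongs to the other side of the circle.\<close>

lemma arc_side_field:
  assumes "arc_side X Y \<gamma> t F" "\<forall>\<^sub>F s in F. 0 < \<sigma> * h (\<gamma> s)" "F \<noteq> bot" "\<sigma> = 1 \<or> \<sigma> = - 1"
  shows "(\<gamma> has_vector_derivative (if \<sigma> = 1 then Y else X) (\<gamma> t)) F"
proof -
  have "\<not> (\<forall>\<^sub>F s in F. \<sigma> * h (\<gamma> s) \<le> 0)"
  proof
    assume "\<forall>\<^sub>F s in F. \<sigma> * h (\<gamma> s) \<le> 0"
    with assms(2) have "\<forall>\<^sub>F s in F. False" by eventually_elim simp
    then show False using assms(3) by simp
  qed
  with assms(1,4) show ?thesis by (auto simp: arc_side_def)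
qed

lemma solution_on_arc:
  assumes side: "\<And>t. arc_side X Y \<gamma> t (at_right t)" "\<And>t. arc_side X Y \<gamma> t (at_left t)"
    and pos: "\<And>s. a < s \<Longrightarrow> s < b \<Longrightarrow> 0 < \<sigma> * h (\<gamma> s)" and \<sigma>: "\<sigma> = 1 \<or> \<sigma> = - 1"
    and t: "t \<in> {a..b}" "a < b"
  shows "(\<gamma> has_vector_derivative (if \<sigma> = 1 then Y else X) (\<gamma> t)) (at t within {a..b})"
proof -
  have r: "(\<gamma> has_vector_derivative (if \<sigma> = 1 then Y else X) (\<gamma> t)) (at_right t)" if "a \<le> t" "t < b"
    using that pos by (intro arc_side_field side(1) \<sigma>) (auto simp: eventually_at_right_field)
  have l: "(\<gamma> has_vector_derivative (if \<sigma> = 1 then Y else X) (\<gamma> t)) (at_left t)" if "a < t" "t \<le> b"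
    using that pos by (intro arc_side_field side(2) \<sigma>) (auto simp: eventually_at_left_field)
  consider "t = a" | "t = b" | "a < t" "t < b" using t by fastforce
  then show ?thesis
  proof cases
    case 1 then show ?thesis using r t by (simp add: at_within_Icc_at_right)
  next
    case 2 then show ?thesis using l t by (simp add: at_within_Icc_at_left)
  next
    case 3
    then have "(\<gamma> has_vector_derivative (if \<sigma> = 1 then Y else X) (\<gamma> t)) (at t)"
      using l r unfolding has_vector_derivative_def has_derivative_within
      by (simp add: at_eq_sup_left_right filterlim_sup)
    then show ?thesis by (rule has_vector_derivative_at_within)
  qed
qed

section \<open>Successive crossings of a periodic path\<close>

locale crossing_path =
  fixes X Y :: vfield and \<gamma> :: "real \<Rightarrow> plane" and T :: real
  assumes T: "0 < T" "\<And>t. \<gamma> (t + T) = \<gamma> t"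
    and side: "\<And>t. arc_side X Y \<gamma> t (at_right t)" "\<And>t. arc_side X Y \<gamma> t (at_left t)"
    and crossing: "\<And>t. h (\<gamma> t) = 0 \<Longrightarrow> 0 < lie_h X (\<gamma> t) * lie_h Y (\<gamma> t)"
begin

lemma continuous_h: "continuous_on S (\<lambda>t. \<sigma> * h (\<gamma> t))"
proof -
  have "continuous_on S \<gamma>"
    using arc_side_isCont[OF side(2,1)] by (simp add: continuous_at_imp_continuous_on)
  then show ?thesis unfolding h_inner by (intro continuous_intros)
qed

lemma crossing_sign: "h (\<gamma> t) = 0 \<Longrightarrow> 0 < \<sigma> * lie_h X (\<gamma> t) \<longleftrightarrow> 0 < \<sigma> * lie_h Y (\<gamma> t)"
  using crossing[of t] by (auto simp: zero_less_mult_iff)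

lemma crossing_nonzero: "h (\<gamma> t) = 0 \<Longrightarrow> lie_h X (\<gamma> t) \<noteq> 0"
  using crossing[of t] by auto

lemma period_mult: "\<gamma> (t + of_nat n * T) = \<gamma> t"
proof (induction n)
  case (Suc n)
  then show ?case using T(2)[of "t + of_nat n * T"] by (simp add: algebra_simps)
qed simp

text \<open>After the crossing at \<open>t\<close> the sign of \<open>h\<close> is \<sigma>, and
  periodicity forces a return to the circle by time \<open>t + T\<close>. At the first return the
  crossing direction is reversed, since the same direction would give \<open>h\<close> the opposite
  sign just before it.\<close>

lemma next_arc:
  assumes L: "traceless_map L \<theta>" "(if \<sigma> = 1 then Y else X) = (\<lambda>z. L (z - c))"
    and \<sigma>: "\<sigma> = 1 \<or> \<sigma> = - 1" and t: "h (\<gamma> t) = 0" "0 < \<sigma> * lie_h X (\<gamma> t)"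
  obtains t' where "t < t'" "arc_from L \<theta> c \<sigma> (\<gamma> t) (\<gamma> t') (t' - t)" "h (\<gamma> t') = 0"
    "\<sigma> * lie_h X (\<gamma> t') < 0" "\<And>s. s \<in> {t..t'} \<Longrightarrow> \<gamma> s = flow L \<theta> c (s - t) (\<gamma> t)"
proof -
  have t2: "0 < \<sigma> * lie_h Y (\<gamma> t)" using t crossing_sign by simp
  obtain e where e: "e > t" "\<And>s. t < s \<Longrightarrow> s < e \<Longrightarrow> 0 < \<sigma> * h (\<gamma> s)"
    using h_sign_right[OF side(1) t(1) t(2) t2] by (auto simp: eventually_at_right_field)
  \<comment> \<open>The search for a zero starts where \<open>\<sigma> * h\<close> is already
    positive, and before \<open>t + T\<close>, where \<open>h\<close> is known to vanish.\<close>
  define s0 where "s0 = min ((t + e) / 2) (t + T / 2)"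
  have s0: "t < s0" "s0 < e" "s0 < t + T" using e T by (auto simp: s0_def min_def)
  obtain t' where t': "s0 < t'" "\<sigma> * h (\<gamma> t') = 0" "\<And>s. s0 \<le> s \<Longrightarrow> s < t' \<Longrightarrow> 0 < \<sigma> * h (\<gamma> s)"
    by (rule first_zero[OF continuous_h, of s0 "t + T" \<sigma>]) (use s0 e t T in auto)
  have pos: "0 < \<sigma> * h (\<gamma> s)" if "t < s" "s < t'" for s
    using e(2)[of s] t'(3)[of s] s0 that by linarith
  have zero: "h (\<gamma> t') = 0" using t' \<sigma> by auto
  have "t < t'" using s0 t' by simp
  have neg: "\<sigma> * lie_h X (\<gamma> t') < 0"
  proof (rule ccontr)
    assume "\<not> \<sigma> * lie_h X (\<gamma> t') < 0"
    then have "0 < \<sigma> * lie_h X (\<gamma> t')" using crossing_nonzero[OF zero] \<sigma> by auto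
    then have "\<forall>\<^sub>F s in at_left t'. \<sigma> * h (\<gamma> s) < 0"
      using h_sign_left[OF side(2) zero] crossing_sign[OF zero] by blast
    moreover have "\<forall>\<^sub>F s in at_left t'. 0 < \<sigma> * h (\<gamma> s)"
      using pos \<open>t < t'\<close> by (auto simp: eventually_at_left_field)
    ultimately have "\<forall>\<^sub>F s in at_left t'. False" by eventually_elim simp
    then show False by simp
  qed
  have fl: "\<gamma> s = flow L \<theta> c (s - t) (\<gamma> t)" if "s \<in> {t..t'}" for s
    using flow_unique[OF L(1) that] solution_on_arc[OF side pos \<sigma> _ \<open>t < t'\<close>] unfolding L(2) by blast
  have lie: "lie_h (\<lambda>z. L (z - c)) z = 2 * (L (z - c) \<bullet> z)" for z
    by (rule lie_h_inner)
  have s1: "0 < \<sigma> * lie_h (\<lambda>z. L (z - c)) (\<gamma> t)"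
    unfolding L(2)[symmetric] using t t2 by auto
  have "- \<sigma> * lie_h Y (\<gamma> t') > 0"
    using neg crossing_sign[OF zero, of "- \<sigma>"] by simp
  then have s2: "\<sigma> * lie_h (\<lambda>z. L (z - c)) (\<gamma> t') < 0"
    unfolding L(2)[symmetric] using neg by auto
  have "arc_from L \<theta> c \<sigma> (\<gamma> t) (\<gamma> t') (t' - t)"
    unfolding arc_from_def
  proof (intro conjI ballI)
    show "flow L \<theta> c (t' - t) (\<gamma> t) = \<gamma> t'" using fl[of t'] \<open>t < t'\<close> by simp
    show "0 < \<sigma> * h (flow L \<theta> c s (\<gamma> t))" if "s \<in> {0<..<t' - t}" for s
      using fl[of "t + s"] pos[of "t + s"] that by simp
  qed (use \<open>t < t'\<close> t zero s1 s2 in \<open>auto simp: S1_iff_h lie algebra_simps\<close>)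
  then show ?thesis using that \<open>t < t'\<close> zero neg fl by blast
qed

text \<open>Exits and entries alternate, so two circle points mean one exit point \<open>p\<close>
  and one entry point \<open>q\<close>. The path may run round the orbit several times within
  \<open>T\<close>, so the image is found by tracing each point back to its last crossing and using
  uniqueness of the arc from there.\<close>

lemma two_arcs:
  assumes L1: "traceless_map L1 \<theta>1" "X = (\<lambda>z. L1 (z - c1))"
    and L2: "traceless_map L2 \<theta>2" "Y = (\<lambda>z. L2 (z - c2))"
    and card: "card (range \<gamma> \<inter> S1) = 2"
  obtains p q a b where "arc_from L2 \<theta>2 c2 1 p q b" "arc_from L1 \<theta>1 c1 (- 1) q p a"
    "range \<gamma> = (\<lambda>t. flow L2 \<theta>2 c2 t p) ` {0..b} \<union> (\<lambda>t. flow L1 \<theta>1 c1 t q) ` {0..a}"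
    "range \<gamma> \<inter> S1 = {p, q}"
proof -
  have next_out: "\<exists>t'. t < t' \<and> arc_from L2 \<theta>2 c2 1 (\<gamma> t) (\<gamma> t') (t' - t) \<and> h (\<gamma> t') = 0 \<and>
      lie_h X (\<gamma> t') < 0 \<and> (\<forall>s\<in>{t..t'}. \<gamma> s = flow L2 \<theta>2 c2 (s - t) (\<gamma> t))"
    if t: "h (\<gamma> t) = 0" "0 < lie_h X (\<gamma> t)" for t
  proof -
    have F: "(if (1::real) = 1 then Y else X) = (\<lambda>z. L2 (z - c2))" using L2(2) by simp
    show ?thesis
    proof (rule next_arc[OF L2(1) F, of t], goal_cases)
      case (4 t')
      show ?case by (intro exI[of _ t'] conjI ballI 4(1,2,3,5)) (use 4(4) in simp)
    qed (use t in auto)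
  qed
  have next_in: "\<exists>t'. t < t' \<and> arc_from L1 \<theta>1 c1 (- 1) (\<gamma> t) (\<gamma> t') (t' - t) \<and> h (\<gamma> t') = 0 \<and>
      0 < lie_h X (\<gamma> t') \<and> (\<forall>s\<in>{t..t'}. \<gamma> s = flow L1 \<theta>1 c1 (s - t) (\<gamma> t))"
    if t: "h (\<gamma> t) = 0" "lie_h X (\<gamma> t) < 0" for t
  proof -
    have F: "(if (- 1::real) = 1 then Y else X) = (\<lambda>z. L1 (z - c1))" using L1(2) by simp
    show ?thesis
    proof (rule next_arc[OF L1(1) F, of t], goal_cases)
      case (4 t')
      show ?case by (intro exI[of _ t'] conjI ballI 4(1,2,3,5)) (use 4(4) in simp)
    qed (use t in auto)
  qed
  obtain t0 where t0: "h (\<gamma> t0) = 0"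
  proof -
    have "range \<gamma> \<inter> S1 \<noteq> {}" using card by auto
    then show ?thesis using that by (auto simp: S1_iff_h)
  qed
  obtain t1 where t1: "h (\<gamma> t1) = 0" "0 < lie_h X (\<gamma> t1)"
  proof (cases "0 < lie_h X (\<gamma> t0)")
    case True
    then show ?thesis using t0 that by blast
  next
    case False
    then have "lie_h X (\<gamma> t0) < 0" using crossing_nonzero[OF t0] by simp
    then show ?thesis using next_in[OF t0] that by blast
  qed
  obtain t2 where t2: "t1 < t2" "arc_from L2 \<theta>2 c2 1 (\<gamma> t1) (\<gamma> t2) (t2 - t1)" "h (\<gamma> t2) = 0"
    "lie_h X (\<gamma> t2) < 0" "\<And>s. s \<in> {t1..t2} \<Longrightarrow> \<gamma> s = flow L2 \<theta>2 c2 (s - t1) (\<gamma> t1)"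
    using next_out[OF t1] by blast
  obtain t3 where t3: "t2 < t3" "arc_from L1 \<theta>1 c1 (- 1) (\<gamma> t2) (\<gamma> t3) (t3 - t2)" "h (\<gamma> t3) = 0"
    "0 < lie_h X (\<gamma> t3)" "\<And>s. s \<in> {t2..t3} \<Longrightarrow> \<gamma> s = flow L1 \<theta>1 c1 (s - t2) (\<gamma> t2)"
    using next_in[OF t2(3,4)] by blast
  define p q where "p = \<gamma> t1" and "q = \<gamma> t2"
  have "p \<noteq> q" using t1 t2(1-4) by (auto simp: p_def q_def)
  moreover have "{p, q} \<subseteq> range \<gamma> \<inter> S1" using t1 t2(1-4) by (auto simp: p_def q_def S1_iff_h)
  moreover have "finite (range \<gamma> \<inter> S1)" using card by (intro card_ge_0_finite) simp
  ultimately have pq: "range \<gamma> \<inter> S1 = {p, q}"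
    using card card_subset_eq[of "range \<gamma> \<inter> S1" "{p, q}"] by simp
  have zero_pq: "\<gamma> t = p \<or> \<gamma> t = q" if "h (\<gamma> t) = 0" for t
  proof -
    have "\<gamma> t \<in> range \<gamma> \<inter> S1" using that by (simp add: S1_iff_h)
    then show ?thesis unfolding pq by simp
  qed
  \<comment> \<open>The sign of the Lie derivative depends only on the point, so it tells
    \<open>p\<close> and \<open>q\<close> apart.\<close>
  have exit_p: "\<gamma> t = p" if "h (\<gamma> t) = 0" "0 < lie_h X (\<gamma> t)" for t
    using zero_pq[OF that(1)] that(2) t2(4) by (auto simp: q_def)
  have entry_q: "\<gamma> t = q" if "h (\<gamma> t) = 0" "lie_h X (\<gamma> t) < 0" for t
    using zero_pq[OF that(1)] that(2) t1(2) by (auto simp: p_def)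
  define a b where "a = t3 - t2" and "b = t2 - t1"
  have out: "arc_from L2 \<theta>2 c2 1 p q b" using t2(1-4) by (simp add: p_def q_def b_def)
  have inn: "arc_from L1 \<theta>1 c1 (- 1) q p a"
    using t3(1-4) exit_p[OF t3(3,4)] by (simp add: q_def a_def)
  have ab: "0 < a" "0 < b" using t2(1) t3(1) by (auto simp: a_def b_def)
  let ?O = "(\<lambda>t. flow L2 \<theta>2 c2 t p) ` {0..b}" and ?I = "(\<lambda>t. flow L1 \<theta>1 c1 t q) ` {0..a}"
  have "?O \<union> ?I \<subseteq> range \<gamma>"
  proof -
    have "flow L2 \<theta>2 c2 t p = \<gamma> (t1 + t)" if "t \<in> {0..b}" for t
      using t2(5)[of "t1 + t"] that by (simp add: p_def b_def)
    moreover have "flow L1 \<theta>1 c1 t q = \<gamma> (t2 + t)" if "t \<in> {0..a}" for t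
      using t3(5)[of "t2 + t"] that by (simp add: q_def a_def)
    ultimately show ?thesis by auto
  qed
  moreover have "\<gamma> t \<in> ?O \<union> ?I" for t
  proof (cases "h (\<gamma> t) = 0")
    case True
    then have "\<gamma> t \<in> {p, q}" using zero_pq by simp
    moreover have "p \<in> ?O" "q \<in> ?I" using ab by (auto intro: image_eqI[of _ _ 0])
    ultimately show ?thesis by auto
  next
    case False
    obtain \<sigma> :: real where \<sigma>: "\<sigma> = 1 \<or> \<sigma> = - 1" "0 < \<sigma> * h (\<gamma> t)"
      using False that[of 1] that[of "- 1"] by (cases "0 < h (\<gamma> t)") auto
    \<comment> \<open>Going back enough periods from \<open>t1\<close> provides some crossing before
      \<open>t\<close>, hence a last one.\<close>
    obtain n where "of_nat n * T > t1 - t" using reals_Archimedean3[OF T(1)] by blast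
    then have z: "t1 - of_nat n * T \<le> t" "h (\<gamma> (t1 - of_nat n * T)) = 0"
      using period_mult[of "t1 - of_nat n * T" n] t1 by auto
    obtain d where d: "d < t" "\<sigma> * h (\<gamma> d) = 0" "\<And>s. d < s \<Longrightarrow> s \<le> t \<Longrightarrow> 0 < \<sigma> * h (\<gamma> s)"
      by (rule last_zero[OF continuous_h z(1) \<sigma>(2)]) (use z(2) in auto)
    have hd: "h (\<gamma> d) = 0" using d \<sigma> by auto
    have sg: "0 < \<sigma> * lie_h X (\<gamma> d)"
    proof (rule ccontr)
      assume "\<not> 0 < \<sigma> * lie_h X (\<gamma> d)"
      then have "0 < - \<sigma> * lie_h X (\<gamma> d)" using crossing_nonzero[OF hd] \<sigma> by auto
      then have "\<forall>\<^sub>F s in at_right d. 0 < - \<sigma> * h (\<gamma> s)"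
        using h_sign_right[OF side(1) hd] crossing_sign[OF hd] by blast
      moreover have "\<forall>\<^sub>F s in at_right d. 0 < \<sigma> * h (\<gamma> s)"
        unfolding eventually_at_right_field using d(1,3) by (meson less_imp_le)
      ultimately have "\<forall>\<^sub>F s in at_right d. False" by eventually_elim simp
      then show False by simp
    qed
    from \<sigma>(1) show ?thesis
    proof
      assume "\<sigma> = 1"
      then have s: "0 < lie_h X (\<gamma> d)" using sg by simp
      have dp: "\<gamma> d = p" using exit_p[OF hd s] .
      obtain t' where t': "d < t'" "arc_from L2 \<theta>2 c2 1 p (\<gamma> t') (t' - d)" "h (\<gamma> t') = 0"
        "\<And>s. s \<in> {d..t'} \<Longrightarrow> \<gamma> s = flow L2 \<theta>2 c2 (s - d) p"
        using next_out[OF hd s] unfolding dp by blast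
      have "t' - d = b" using arc_from_unique[OF t'(2) out] by simp
      moreover have "t < t'" using d(3)[of t'] t'(1,3) by (cases "t' \<le> t") auto
      ultimately show ?thesis using t'(4)[of t] d(1) by auto
    next
      assume "\<sigma> = - 1"
      then have s: "lie_h X (\<gamma> d) < 0" using sg by simp
      have dq: "\<gamma> d = q" using entry_q[OF hd s] .
      obtain t' where t': "d < t'" "arc_from L1 \<theta>1 c1 (- 1) q (\<gamma> t') (t' - d)" "h (\<gamma> t') = 0"
        "\<And>s. s \<in> {d..t'} \<Longrightarrow> \<gamma> s = flow L1 \<theta>1 c1 (s - d) q"
        using next_in[OF hd s] unfolding dq by blast
      have "t' - d = a" using arc_from_unique[OF t'(2) inn] by simp
      moreover have "t < t'" using d(3)[of t'] t'(1,3) by (cases "t' \<le> t") auto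
      ultimately show ?thesis using t'(4)[of t] d(1) by auto
    qed
  qed
  ultimately have "range \<gamma> = ?O \<union> ?I" by auto
  then show ?thesis using that out inn pq by blast
qed

end

lemma crossing_periodic_orbit_two_arcs:
  assumes L1: "traceless_map L1 \<theta>1" "X = (\<lambda>z. L1 (z - c1))"
    and L2: "traceless_map L2 \<theta>2" "Y = (\<lambda>z. L2 (z - c2))"
    and \<Gamma>: "crossing_periodic_orbit X Y U \<Gamma>" and card: "card (\<Gamma> \<inter> S1) = 2"
  obtains p q a b where "arc_from L2 \<theta>2 c2 1 p q b" "arc_from L1 \<theta>1 c1 (- 1) q p a"
    "\<Gamma> = (\<lambda>t. flow L2 \<theta>2 c2 t p) ` {0..b} \<union> (\<lambda>t. flow L1 \<theta>1 c1 t q) ` {0..a}"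
    "\<Gamma> \<inter> S1 = {p, q}" "\<Gamma> \<subseteq> U"
proof -
  obtain \<gamma>0 T where \<gamma>0: "closed_trajectory X Y U \<gamma>0 T" "concatenation_of_arcs X Y \<gamma>0 T" "\<Gamma> = \<gamma>0 ` {0..T}"
    and cr: "\<Gamma> \<inter> S1 \<subseteq> crossing_region X Y"
    using \<Gamma> by (auto simp: crossing_periodic_orbit_def)
  have T: "0 < T" "\<gamma>0 T = \<gamma>0 0" and U: "\<Gamma> \<subseteq> U"
    using \<gamma>0 by (auto simp: closed_trajectory_def trajectory_on_def)
  obtain \<gamma> where \<gamma>: "\<And>t. \<gamma> (t + T) = \<gamma> t" "\<gamma>0 ` {0..T} = range \<gamma>"
    "\<And>t. arc_side X Y \<gamma> t (at_right t)" "\<And>t. arc_side X Y \<gamma> t (at_left t)"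
    using periodic_extension[OF \<gamma>0(2) T] by blast
  have "crossing_path X Y \<gamma> T"
  proof
    fix t assume "h (\<gamma> t) = 0"
    then have "\<gamma> t \<in> \<Gamma> \<inter> S1" using \<gamma>0(3) \<gamma>(2) by (auto simp: S1_iff_h)
    then show "0 < lie_h X (\<gamma> t) * lie_h Y (\<gamma> t)" using cr by (auto simp: crossing_region_def)
  qed (use T \<gamma> in auto)
  then show ?thesis
  proof (rule crossing_path.two_arcs[OF _ L1 L2])
    show "card (range \<gamma> \<inter> S1) = 2" using card \<gamma>0(3) \<gamma>(2) by simp
  qed (use that \<gamma>0(3) \<gamma>(2) U in auto)
qed

section \<open>Midpoints of chords and the cubic\<close>

text \<open>The quadratic form of \<open>L\<close> takes opposite values at the two ends of a
  quarter turn because the trace is zero, so it vanishes at some unit \<open>u\<close>. There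
  \<open>L\<close> swaps the axes, and the product of its two coefficients is \<theta>, so they have
  the same sign.\<close>

lemma traceless_saddle_basis:
  assumes L: "traceless_map L \<theta>" and \<theta>: "0 < \<theta>"
  obtains u P Q where "u \<bullet> u = 1" "0 < P" "0 < Q" "L u = Q *\<^sub>R perp u" "L (perp u) = P *\<^sub>R u"
proof -
  note LD = traceless_mapD[OF L]
  define e where "e \<phi> = cos \<phi> *\<^sub>R axis 1 1 + sin \<phi> *\<^sub>R perp (axis 1 1)" for \<phi> :: real
  let ?f = "\<lambda>\<phi>. e \<phi> \<bullet> L (e \<phi>)"
  have cont: "continuous_on S ?f" for S
    unfolding e_def by (intro continuous_intros linear_continuous_on_compose[OF _ LD(1)])
  have e0: "e 0 = axis 1 1" "e (pi / 2) = perp (axis 1 1)" by (simp_all add: e_def)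
  have "?f 0 = - ?f (pi / 2)" unfolding e0 using LD(5)[of "axis 1 1"] by simp
  then obtain \<phi> where \<phi>: "?f \<phi> = 0"
    using IVT'[of ?f 0 0 "pi / 2"] IVT2'[of ?f "pi / 2" 0 0] cont pi_gt_zero
    by (cases "?f 0 \<le> 0") force+
  define u where "u = e \<phi>"
  have "(axis 1 1 :: plane) \<bullet> axis 1 1 = 1" by (simp add: inner_axis_axis)
  then have u: "u \<bullet> u = 1"
    by (simp add: u_def e_def inner_add_left inner_add_right power2_eq_square[symmetric])
  have "u \<bullet> L u = 0" "perp u \<bullet> L (perp u) = 0"
    using \<phi> LD(5)[of u] by (simp_all add: u_def)
  then obtain Q P where Lu: "L u = Q *\<^sub>R perp u" and Lv: "L (perp u) = P *\<^sub>R u"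
    using orthonormal_expansion[OF u, of "L u"] orthonormal_expansion[OF u, of "L (perp u)"]
    by (simp add: inner_commute)
  have "L (L u) = (Q * P) *\<^sub>R u"
    unfolding Lu linear_scale[OF LD(1)] Lv by simp
  then have "(Q * P - \<theta>) *\<^sub>R u = 0"
    unfolding LD(4) by (auto simp: scaleR_diff_left)
  moreover have "u \<noteq> 0" using u by auto
  ultimately have "Q * P = \<theta>" by simp
  then consider "0 < Q" "0 < P" | "Q < 0" "P < 0" using \<theta> by (auto simp: zero_less_mult_iff)
  then show ?thesis
  proof cases
    case 1
    then show ?thesis using that u Lu Lv by blast
  next
    case 2
    then show ?thesis
      \<comment> \<open>Turning the frame by a right angle exchanges the two coefficients and
        changes both signs.\<close>
      using that[of "perp u" "- Q" "- P"] u Lu Lv LD(1) by (simp add: linear_neg)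
  qed
qed

text \<open>Successive divided differences at the roots. Since \<open>k3\<close> may be zero, this
  includes the fact that degree at most two with three roots forces the zero polynomial.\<close>

lemma cubic_three_roots:
  fixes k0 k1 k2 k3 :: real
  assumes f: "\<And>z. f z = k0 + k1 * z + k2 * z^2 + k3 * z^3"
    and roots: "f r = 0" "f s = 0" "f t = 0" and dist: "r \<noteq> s" "r \<noteq> t" "s \<noteq> t"
  shows "f z = k3 * ((z - r) * (z - s) * (z - t))"
proof -
  have "(r - s) * (k1 + k2 * (r + s) + k3 * (r^2 + r * s + s^2)) = f r - f s"
    "(r - t) * (k1 + k2 * (r + t) + k3 * (r^2 + r * t + t^2)) = f r - f t"
    by (simp_all add: f algebra_simps power2_eq_square power3_eq_cube)
  then have rs: "k1 + k2 * (r + s) + k3 * (r^2 + r * s + s^2) = 0"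
    and rt: "k1 + k2 * (r + t) + k3 * (r^2 + r * t + t^2) = 0"
    using roots dist by simp_all
  have "(s - t) * (k2 + k3 * (r + s + t)) = 0"
    using rs rt by (simp add: algebra_simps power2_eq_square)
  then have k2: "k2 = - k3 * (r + s + t)" using dist by simp
  have k1: "k1 = - k2 * (r + s) - k3 * (r^2 + r * s + s^2)" using rs by simp
  have k0: "k0 = - k1 * r - k2 * r^2 - k3 * r^3" using roots(1) by (simp add: f)
  show ?thesis
    unfolding f k0 k1 k2 by (simp add: algebra_simps power2_eq_square power3_eq_cube)
qed

text \<open>Evaluating the cubic at \<open>P\<close> and \<open>- Q\<close> gives the product of the ratios \<open>(P - \<nu>) / (Q + \<nu>)\<close> over the
  roots, while the crossing condition puts every ratio strictly on the same side of the cube root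
  of that product.\<close>

lemma three_chords_cubic_vanishes:
  fixes a b c e x y P Q :: real
  defines "f \<nu> \<equiv> a * (x^2 * (P - \<nu>)^2 - y^2 * (Q + \<nu>)^2) + b * (x * y * ((P - \<nu>) * (Q + \<nu>))) -
    c * (x * ((P - \<nu>)^2 * (Q + \<nu>))) - e * (y * ((P - \<nu>) * (Q + \<nu>)^2))"
  defines "good \<nu> \<equiv> 0 < P - \<nu> \<and> 0 < Q + \<nu> \<and> 0 < \<nu> * ((P - \<nu>)^3 * x^2 - (Q + \<nu>)^3 * y^2)"
  assumes PQ: "0 < P" "0 < Q"
    and good: "good r" "good s" "good t" and roots: "f r = 0" "f s = 0" "f t = 0"
    and dist: "r \<noteq> s" "r \<noteq> t" "s \<noteq> t"
  shows "f \<nu> = 0"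
proof -
  define k3 where "k3 = - c * x + e * y"
  define k2 where "k2 = a * (x^2 - y^2) - b * (x * y) - c * (x * (Q - 2 * P)) - e * (y * (P - 2 * Q))"
  define k1 where "k1 = a * (- 2 * P * x^2 - 2 * Q * y^2) + b * (x * y * (P - Q)) -
    c * (x * (P^2 - 2 * P * Q)) - e * (y * (2 * P * Q - Q^2))"
  define k0 where "k0 = a * (P^2 * x^2 - Q^2 * y^2) + b * (x * y * (P * Q)) - c * (x * (P^2 * Q)) - e * (y * (P * Q^2))"
  have f: "f z = k0 + k1 * z + k2 * z^2 + k3 * z^3" for z
    unfolding f_def k0_def k1_def k2_def k3_def
    by (simp add: algebra_simps power2_eq_square power3_eq_cube)
  note prod = cubic_three_roots[of f, OF f roots dist]
  have "k3 = 0"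
  proof (rule ccontr)
    assume k3: "k3 \<noteq> 0"
    define N1 where "N1 = (P - r) * (P - s) * (P - t)"
    define N2 where "N2 = (Q + r) * (Q + s) * (Q + t)"
    have N: "0 < N1" "0 < N2" using good by (auto simp: N1_def N2_def good_def)
    \<comment> \<open>At \<open>P\<close>, and below at \<open>- Q\<close>, every term of
      \<open>f\<close> but one square drops out. Both surviving terms carry the same coefficient
      \<open>a\<close>, so \<open>a\<close> and \<open>k3\<close> can be eliminated.\<close>
    have fP: "a * (P + Q)^2 * y^2 = - k3 * N1"
      using prod[of P] by (simp add: f_def N1_def algebra_simps)
    have "f (- Q) = - k3 * N2"
      unfolding prod N2_def by (simp add: algebra_simps)
    then have fQ: "a * (P + Q)^2 * x^2 = - k3 * N2"
      by (simp add: f_def algebra_simps)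
    have "a * (P + Q)^2 * (y^2 * N2) = a * (P + Q)^2 * (x^2 * N1)"
      using fP fQ by algebra
    moreover have "a * (P + Q)^2 \<noteq> 0" using fP k3 N by auto
    ultimately have eq: "y^2 * N2 = x^2 * N1" by simp
    have "x \<noteq> 0" "y \<noteq> 0" using fP fQ k3 N by auto
    then have xy: "0 < x^2" "0 < y^2" by simp_all
    \<comment> \<open>\<open>?F\<close> is decreasing, so a good positive \<nu> forces
      \<open>?F 0\<close> to be positive and a good negative one forces it to be negative. All good
      parameters therefore share one sign, and \<open>?F\<close> has that sign at each of
      them.\<close>
    let ?F = "\<lambda>\<nu>. (P - \<nu>)^3 * x^2 - (Q + \<nu>)^3 * y^2"
    have F_pos: "0 < ?F 0" if "good \<nu>" "0 < \<nu>" for \<nu>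
    proof -
      have "0 < ?F \<nu>" using that by (auto simp: good_def zero_less_mult_iff)
      moreover have "(P - \<nu>)^3 \<le> P^3" "Q^3 \<le> (Q + \<nu>)^3"
        using that PQ by (auto intro!: power_mono simp: good_def)
      then have "(P - \<nu>)^3 * x^2 \<le> P^3 * x^2" "Q^3 * y^2 \<le> (Q + \<nu>)^3 * y^2"
        by (auto intro!: mult_right_mono)
      ultimately show ?thesis by simp
    qed
    have F_neg: "?F 0 < 0" if "good \<nu>" "\<nu> < 0" for \<nu>
    proof -
      have "?F \<nu> < 0" using that by (auto simp: good_def zero_less_mult_iff)
      moreover have "P^3 \<le> (P - \<nu>)^3" "(Q + \<nu>)^3 \<le> Q^3"
        using that PQ by (auto intro!: power_mono simp: good_def)
      then have "P^3 * x^2 \<le> (P - \<nu>)^3 * x^2" "(Q + \<nu>)^3 * y^2 \<le> Q^3 * y^2"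
        by (auto intro!: mult_right_mono)
      ultimately show ?thesis by simp
    qed
    have nz: "\<nu> \<noteq> 0" if "good \<nu>" for \<nu> using that by (auto simp: good_def)
    \<comment> \<open>Cubing distributes the sixth power of \<open>x\<close> as one square per root,
      matching the three terms of \<open>?F\<close>; three strict inequalities in one direction then
      contradict equality of the products.\<close>
    have "(x^2 * N1)^3 = ((P - r)^3 * x^2) * ((P - s)^3 * x^2) * ((P - t)^3 * x^2)"
      "(y^2 * N2)^3 = ((Q + r)^3 * y^2) * ((Q + s)^3 * y^2) * ((Q + t)^3 * y^2)"
      unfolding N1_def N2_def by (simp_all add: power3_eq_cube)
    with eq have eq3: "((P - r)^3 * x^2) * ((P - s)^3 * x^2) * ((P - t)^3 * x^2) =
        ((Q + r)^3 * y^2) * ((Q + s)^3 * y^2) * ((Q + t)^3 * y^2)" by simp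
    have pos: "0 < (P - \<nu>)^3 * x^2" "0 < (Q + \<nu>)^3 * y^2" if "good \<nu>" for \<nu>
      using that xy by (auto simp: good_def)
    have strict: "A1 * A2 * A3 < B1 * B2 * B3"
      if "0 < A1" "0 < A2" "0 < A3" "A1 < B1" "A2 < B2" "A3 < B3" for A1 A2 A3 B1 B2 B3 :: real
      using that by (intro mult_strict_mono) (auto intro!: mult_pos_pos less_trans[of 0 A1 B1])
    show False
    proof (cases "0 < ?F 0")
      case True
      have "(Q + \<nu>)^3 * y^2 < (P - \<nu>)^3 * x^2" if "good \<nu>" for \<nu>
        using F_neg[OF that] nz[OF that] True that by (auto simp: good_def zero_less_mult_iff)
      then show False using strict[OF pos(2)[OF good(1)] pos(2)[OF good(2)] pos(2)[OF good(3)]] good eq3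
        by fastforce
    next
      case False
      have "(P - \<nu>)^3 * x^2 < (Q + \<nu>)^3 * y^2" if "good \<nu>" for \<nu>
        using F_pos[OF that] nz[OF that] False that by (auto simp: good_def zero_less_mult_iff)
      then show False using strict[OF pos(1)[OF good(1)] pos(1)[OF good(2)] pos(1)[OF good(3)]] good eq3
        by fastforce
    qed
  qed
  then show ?thesis using prod by simp
qed

lemma finite_card_le_2I:
  assumes "\<And>x y z. x \<in> A \<Longrightarrow> y \<in> A \<Longrightarrow> z \<in> A \<Longrightarrow> x = y \<or> x = z \<or> y = z"
  shows "finite A \<and> card A \<le> 2"
proof (rule ccontr)
  assume "\<not> (finite A \<and> card A \<le> 2)"
  then obtain B where "B \<subseteq> A" "card B = 3"
    using infinite_arbitrarily_large[of A 3] obtain_subset_with_card_n[of 3 A] by fastforce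
  then obtain x y z where "x \<in> A" "y \<in> A" "z \<in> A" "x \<noteq> y" "y \<noteq> z" "x \<noteq> z"
    by (auto simp: card_3_iff)
  then show False using assms[of x y z] by blast
qed

text \<open>The solution \<open>z\<close> of \<open>L (z - c) = - \<nu> *\<^sub>R perp z\<close>
  when \<open>L\<close> swaps the axes \<open>u\<close> and \<open>perp u\<close> with factors
  \<open>Q\<close> and \<open>P\<close>: the equation decouples into one scalar equation per
  coordinate.\<close>

definition mid :: "plane \<Rightarrow> plane \<Rightarrow> real \<Rightarrow> real \<Rightarrow> real \<Rightarrow> plane" where
  "mid u c P Q \<nu> = (Q * (c \<bullet> u) / (Q + \<nu>)) *\<^sub>R u + (P * (c \<bullet> perp u) / (P - \<nu>)) *\<^sub>R perp u"

text \<open>The vector from the midpoint \<open>m\<close> to an end of its chord of the unit circle: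
  \<open>perp m\<close> rescaled to the length required by Pythagoras, with the sign
  \<open>s\<close> choosing the end.\<close>

definition half_chord :: "real \<Rightarrow> plane \<Rightarrow> plane" where
  "half_chord s m = - (s * sqrt ((1 - m \<bullet> m) / (m \<bullet> m))) *\<^sub>R perp m"

lemma perp_linear [simp]:
  "perp (x + y) = perp x + perp y" "perp (r *\<^sub>R x) = r *\<^sub>R perp x" "perp (- x) = - perp x"
  by (simp_all add: perp_def vec_eq_iff forall_2)

lemma half_chord_in_S1:
  assumes "m \<noteq> 0" "m \<bullet> m < 1" "s\<^sup>2 = 1"
  shows "m - half_chord s m \<in> S1" "m + half_chord s m \<in> S1"
proof -
  have "(s * sqrt ((1 - m \<bullet> m) / (m \<bullet> m)))\<^sup>2 * (m \<bullet> m) = 1 - m \<bullet> m"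
    using assms by (simp add: power_mult_distrib)
  then have e: "half_chord s m \<bullet> half_chord s m = 1 - m \<bullet> m" "half_chord s m \<bullet> m = 0" "m \<bullet> half_chord s m = 0"
    by (simp_all add: half_chord_def power2_eq_square)
  then show "m - half_chord s m \<in> S1" "m + half_chord s m \<in> S1"
    by (simp_all add: S1_iff_inner inner_diff_left inner_diff_right inner_add_left inner_add_right)
qed

section \<open>Chords of the outer saddle in the frame that it swaps\<close>

locale saddle_frame =
  fixes L :: "plane \<Rightarrow> plane" and \<theta> :: real and c u :: plane and P Q :: real
  assumes L: "traceless_map L \<theta>" and \<theta>: "0 < \<theta>"
    and u: "u \<bullet> u = 1" and PQ: "0 < P" "0 < Q"
    and Lu: "L u = Q *\<^sub>R perp u" and Lv: "L (perp u) = P *\<^sub>R u"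
begin

abbreviation X0 :: real where "X0 \<equiv> Q * (c \<bullet> u)"
abbreviation Y0 :: real where "Y0 \<equiv> P * (c \<bullet> perp u)"
abbreviation m :: "real \<Rightarrow> plane" where "m \<nu> \<equiv> mid u c P Q \<nu>"

text \<open>With midpoint coordinates \<open>x = X0 / (Q + \<nu>)\<close> and
  \<open>y = Y0 / (P - \<nu>)\<close>, the last clause is \<open>0 < \<nu> * ((P - \<nu>) *
  x\<^sup>2 - (Q + \<nu>) * y\<^sup>2)\<close> cleared of denominators, whence the cubes.\<close>

definition good :: "real \<Rightarrow> bool" where
  "good \<nu> \<longleftrightarrow> 0 < P - \<nu> \<and> 0 < Q + \<nu> \<and> 0 < \<nu> * ((P - \<nu>)^3 * X0^2 - (Q + \<nu>)^3 * Y0^2)"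

lemma L_coords: "L z = (P * (z \<bullet> perp u)) *\<^sub>R u + (Q * (z \<bullet> u)) *\<^sub>R perp u"
proof -
  have "L z = L ((z \<bullet> u) *\<^sub>R u + (z \<bullet> perp u) *\<^sub>R perp u)"
    using orthonormal_expansion[OF u, of z] by simp
  then show ?thesis
    using traceless_mapD(1)[OF L] by (simp add: linear_add linear_scale Lu Lv mult.commute)
qed

lemma L_mid:
  assumes "Q + \<nu> \<noteq> 0" "P - \<nu> \<noteq> 0"
  shows "L (m \<nu> - c) = - \<nu> *\<^sub>R perp (m \<nu>)"
proof -
  have x: "Q * (X0 / (Q + \<nu>) - c \<bullet> u) = - \<nu> * (X0 / (Q + \<nu>))"
    using assms by (simp add: field_simps)
  have y: "P * (Y0 / (P - \<nu>) - c \<bullet> perp u) = \<nu> * (Y0 / (P - \<nu>))"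
    using assms by (simp add: field_simps)
  have "(m \<nu> - c) \<bullet> u = X0 / (Q + \<nu>) - c \<bullet> u" "(m \<nu> - c) \<bullet> perp u = Y0 / (P - \<nu>) - c \<bullet> perp u"
    using u by (simp_all add: mid_def inner_diff_left inner_add_left)
  then have "L (m \<nu> - c) = (\<nu> * (Y0 / (P - \<nu>))) *\<^sub>R u + (- \<nu> * (X0 / (Q + \<nu>))) *\<^sub>R perp u"
    unfolding L_coords by (simp only: x y)
  then show ?thesis by (simp add: mid_def scaleR_add_right scaleR_diff_right)
qed

lemma mid_unique:
  assumes "Q + \<nu> \<noteq> 0" "P - \<nu> \<noteq> 0" and z: "L (z - c) = - \<nu> *\<^sub>R perp z"
  shows "z = m \<nu>"
proof -
  have "perp z = (z \<bullet> u) *\<^sub>R perp u - (z \<bullet> perp u) *\<^sub>R u"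
    by (subst orthonormal_expansion[OF u, of z]) simp
  then have eq: "(P * ((z - c) \<bullet> perp u)) *\<^sub>R u + (Q * ((z - c) \<bullet> u)) *\<^sub>R perp u =
      (\<nu> * (z \<bullet> perp u)) *\<^sub>R u + (- \<nu> * (z \<bullet> u)) *\<^sub>R perp u"
    using z unfolding L_coords by (simp add: scaleR_diff_right)
  from arg_cong[OF eq, of "\<lambda>w. w \<bullet> u"] have "P * ((z - c) \<bullet> perp u) = \<nu> * (z \<bullet> perp u)"
    using u by (simp add: inner_add_left inner_diff_left)
  then have y: "z \<bullet> perp u = Y0 / (P - \<nu>)"
    using assms(2) by (simp add: inner_diff_left field_simps)
  from arg_cong[OF eq, of "\<lambda>w. w \<bullet> perp u"] have "Q * ((z - c) \<bullet> u) = - \<nu> * (z \<bullet> u)"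
    using u by (simp add: inner_add_left inner_diff_left)
  then have x: "z \<bullet> u = X0 / (Q + \<nu>)"
    using assms(1) by (simp add: inner_diff_left field_simps)
  show ?thesis
    using orthonormal_expansion[OF u, of z] unfolding mid_def x y .
qed

text \<open>With \<open>E = - \<delta> *\<^sub>R perp M\<close> and
  \<open>\<nu> = \<kappa> * \<delta>\<close>, positivity of \<kappa> on a saddle arc makes
  \<open>sgn \<nu>\<close> the orientation of the chord.\<close>

lemma outer_chord:
  assumes arc: "arc_from L \<theta> c 1 p q a"
  obtains \<nu> where "good \<nu>" "m \<nu> \<noteq> 0" "m \<nu> \<bullet> m \<nu> < 1"
    "p = m \<nu> - half_chord (sgn \<nu>) (m \<nu>)" "q = m \<nu> + half_chord (sgn \<nu>) (m \<nu>)"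
proof -
  note lin = traceless_mapD(1)[OF L]
  define M E where "M = (1/2) *\<^sub>R (p + q)" and "E = (1/2) *\<^sub>R (q - p)"
  have pq: "p = M - E" "q = M + E" by (simp_all add: M_def E_def vec_eq_iff field_simps)
  define \<kappa> where "\<kappa> = cs \<theta> (a/2) / sn \<theta> (a/2)"
  have \<kappa>: "0 < \<kappa>" using cs_pos[OF \<theta>] arc_from_chord(2)[OF L arc] by (simp add: \<kappa>_def)
  have LM: "L (M - c) = \<kappa> *\<^sub>R E"
    using arc_from_chord(1)[OF L arc] by (simp add: M_def E_def \<kappa>_def)
  have S1: "p \<bullet> p = 1" "q \<bullet> q = 1" using arc by (auto simp: arc_from_def S1_iff_inner)
  have EM: "E \<bullet> M = 0"
    using S1 by (simp add: M_def E_def inner_diff_left inner_diff_right inner_add_left inner_add_right inner_commute)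
  have norm: "M \<bullet> M + E \<bullet> E = 1"
    using S1(2) EM unfolding pq by (simp add: inner_add_left inner_add_right inner_commute)
  have E0: "E \<noteq> 0" using arc_from_neq[OF arc] pq by auto
  then have EE: "0 < E \<bullet> E" by simp
  \<comment> \<open>Subtracting the exit inequality at \<open>p\<close> from the entry inequality at
    \<open>q\<close> cancels the terms \<open>L E \<bullet> E\<close>.\<close>
  have cross: "\<kappa> * (E \<bullet> E) + L E \<bullet> M < 0"
  proof -
    have "L (p - c) = \<kappa> *\<^sub>R E - L E" "L (q - c) = \<kappa> *\<^sub>R E + L E"
      using lin LM unfolding pq
      by (simp_all add: linear_diff linear_add algebra_simps)
    moreover have "0 < L (p - c) \<bullet> p" "L (q - c) \<bullet> q < 0" using arc by (auto simp: arc_from_def)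
    ultimately show ?thesis
      using EM unfolding pq
      by (simp add: inner_diff_left inner_diff_right inner_add_left inner_add_right inner_commute)
  qed
  have M0: "M \<noteq> 0"
  proof
    assume "M = 0"
    then have "\<kappa> * (E \<bullet> E) < 0" using cross by simp
    then show False using mult_pos_pos[OF \<kappa> EE] by linarith
  qed
  then have MM: "0 < M \<bullet> M" by simp
  define \<delta> where "\<delta> = - ((E \<bullet> perp M) / (M \<bullet> M))"
  have E: "E = (- \<delta>) *\<^sub>R perp M"
    using orthogonal_imp_perp[OF M0 EM] by (simp add: \<delta>_def)
  define \<nu> where "\<nu> = \<kappa> * \<delta>"
  have LM': "L (M - c) = - \<nu> *\<^sub>R perp M" unfolding LM by (subst E) (simp add: \<nu>_def)
  define x y where "x = M \<bullet> u" and "y = M \<bullet> perp u"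
  have M: "M = x *\<^sub>R u + y *\<^sub>R perp u" unfolding x_def y_def by (rule orthonormal_expansion[OF u])
  have MMxy: "M \<bullet> M = x\<^sup>2 + y\<^sup>2"
    unfolding M using u by (simp add: inner_add_left inner_add_right power2_eq_square)
  have LvM: "L (perp M) \<bullet> M = P * x\<^sup>2 - Q * y\<^sup>2"
    unfolding M using u lin
    by (simp add: linear_add linear_diff linear_scale linear_neg Lu Lv inner_add_left inner_add_right inner_diff_left power2_eq_square algebra_simps)
  have "L E \<bullet> M = - \<delta> * (P * x\<^sup>2 - Q * y\<^sup>2)"
    using lin LvM by (subst E) (simp add: linear_scale linear_neg)
  moreover have "E \<bullet> E = \<delta>\<^sup>2 * (x\<^sup>2 + y\<^sup>2)"
    unfolding MMxy[symmetric] by (subst (1 2) E) (simp add: power2_eq_square)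
  ultimately have "\<kappa> * (\<kappa> * (\<delta>\<^sup>2 * (x\<^sup>2 + y\<^sup>2)) + - \<delta> * (P * x\<^sup>2 - Q * y\<^sup>2)) < 0"
    using cross \<kappa> by (simp add: mult_pos_neg)
  then have key: "0 < \<nu> * ((P - \<nu>) * x\<^sup>2 - (Q + \<nu>) * y\<^sup>2)"
    by (simp add: \<nu>_def algebra_simps power2_eq_square)
  \<comment> \<open>The sign of \<nu> makes one of the two factors positive outright;
    \<open>key\<close> then forces the other.\<close>
  have AB: "0 < P - \<nu> \<and> 0 < Q + \<nu>"
  proof (cases "0 < \<nu>")
    case True
    then have B: "0 < Q + \<nu>" using PQ by simp
    have "(Q + \<nu>) * y\<^sup>2 < (P - \<nu>) * x\<^sup>2" using key True by (simp add: zero_less_mult_iff)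
    moreover have "0 \<le> (Q + \<nu>) * y\<^sup>2" using B by simp
    ultimately have "0 < (P - \<nu>) * x\<^sup>2" by linarith
    then show ?thesis using B by (auto simp: zero_less_mult_iff)
  next
    case False
    then have A: "0 < P - \<nu>" using PQ by simp
    have "(P - \<nu>) * x\<^sup>2 < (Q + \<nu>) * y\<^sup>2" using key False by (simp add: zero_less_mult_iff)
    moreover have "0 \<le> (P - \<nu>) * x\<^sup>2" using A by simp
    ultimately have "0 < (Q + \<nu>) * y\<^sup>2" by linarith
    then show ?thesis using A by (auto simp: zero_less_mult_iff)
  qed
  have mid: "M = m \<nu>" using mid_unique[OF _ _ LM'] AB by simp
  have x: "x * (Q + \<nu>) = X0" and y: "y * (P - \<nu>) = Y0"
    using u AB unfolding x_def y_def mid by (simp_all add: mid_def inner_add_left)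
  have good: "good \<nu>"
  proof -
    have "0 < ((P - \<nu>) * (Q + \<nu>))\<^sup>2 * (\<nu> * ((P - \<nu>) * x\<^sup>2 - (Q + \<nu>) * y\<^sup>2))"
      using AB by (intro mult_pos_pos[OF _ key]) simp
    also have "\<dots> = \<nu> * ((P - \<nu>)^3 * (x * (Q + \<nu>))\<^sup>2 - (Q + \<nu>)^3 * (y * (P - \<nu>))\<^sup>2)"
      by (simp add: power2_eq_square power3_eq_cube algebra_simps)
    finally show ?thesis unfolding good_def x y using AB by simp
  qed
  have "(1 - M \<bullet> M) / (M \<bullet> M) = \<delta>\<^sup>2"
  proof -
    have "E \<bullet> E = \<delta>\<^sup>2 * (M \<bullet> M)" by (subst (1 2) E) (simp add: power2_eq_square)
    then show ?thesis using norm MM by (simp add: field_simps)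
  qed
  moreover have "sgn \<nu> = sgn \<delta>" using \<kappa> by (simp add: \<nu>_def sgn_mult)
  ultimately have "E = half_chord (sgn \<nu>) (m \<nu>)"
    unfolding half_chord_def mid[symmetric] using E by (simp add: sgn_mult_abs)
  then show ?thesis
    using that[OF good] M0 pq norm EE unfolding mid by auto
qed

text \<open>For an inner center the multiplier \<open>cs / sn\<close> can have either sign or
  vanish, so only the direction is retained: the field at \<open>M\<close> is parallel to the chord,
  hence orthogonal to \<open>M\<close>.\<close>

lemma inner_chord:
  assumes L1: "traceless_map L1 \<theta>1" and arc: "arc_from L1 \<theta>1 c1 \<sigma> q p a"
    and pq: "p = M - E" "q = M + E"
  shows "M \<bullet> L1 (M - c1) = 0"
proof -
  have S1: "p \<bullet> p = 1" "q \<bullet> q = 1" using arc by (auto simp: arc_from_def S1_iff_inner)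
  have EM: "M \<bullet> E = 0"
    using S1 unfolding pq by (simp add: inner_diff_left inner_diff_right inner_add_left inner_add_right inner_commute)
  have "(1/2) *\<^sub>R (q + p) = M" "(1/2) *\<^sub>R (p - q) = - E"
    unfolding pq by (simp_all add: vec_eq_iff)
  then show ?thesis
    using arc_from_chord(1)[OF L1 arc] EM by simp
qed

text \<open>Clearing the denominators of \<open>m \<nu>\<close> leaves degree two from the quadratic
  part and degree three from the part linear in \<open>m \<nu>\<close>. Trace zero of
  \<open>L1\<close> gives the two pure squares opposite coefficients, so the values at
  \<open>P\<close> and \<open>- Q\<close> share one coefficient.\<close>

lemma inner_condition_cubic:
  assumes L1: "traceless_map L1 \<theta>1" and \<nu>: "Q + \<nu> \<noteq> 0" "P - \<nu> \<noteq> 0"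
  shows "((P - \<nu>) * (Q + \<nu>))\<^sup>2 * (m \<nu> \<bullet> L1 (m \<nu> - c1)) =
    (u \<bullet> L1 u) * (X0^2 * (P - \<nu>)^2 - Y0^2 * (Q + \<nu>)^2) +
    (u \<bullet> L1 (perp u) + perp u \<bullet> L1 u) * (X0 * Y0 * ((P - \<nu>) * (Q + \<nu>))) -
    (u \<bullet> L1 c1) * (X0 * ((P - \<nu>)^2 * (Q + \<nu>))) - (perp u \<bullet> L1 c1) * (Y0 * ((P - \<nu>) * (Q + \<nu>)^2))"
proof -
  note lin = traceless_mapD(1)[OF L1]
  define A B where "A = P - \<nu>" and "B = Q + \<nu>"
  define x y where "x = X0 / B" and "y = Y0 / A"
  have xy: "B * x = X0" "A * y = Y0" using \<nu> by (simp_all add: x_def y_def A_def B_def)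
  have v: "perp u \<bullet> L1 (perp u) = - (u \<bullet> L1 u)" using traceless_mapD(5)[OF L1, of u] by simp
  have m: "m \<nu> = x *\<^sub>R u + y *\<^sub>R perp u" by (simp add: mid_def x_def y_def A_def B_def)
  have eq: "m \<nu> \<bullet> L1 (m \<nu> - c1) = (u \<bullet> L1 u) * (x\<^sup>2 - y\<^sup>2) + (u \<bullet> L1 (perp u) + perp u \<bullet> L1 u) * (x * y) -
      (u \<bullet> L1 c1) * x - (perp u \<bullet> L1 c1) * y"
    unfolding m using lin v
    by (simp add: linear_diff linear_add linear_scale inner_add_left inner_add_right inner_diff_right algebra_simps power2_eq_square)
  show ?thesis
    unfolding A_def[symmetric] B_def[symmetric] xy[symmetric] eq
    by (simp add: algebra_simps power2_eq_square)
qed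

end

section \<open>Limit cycles\<close>

lemma isCont_eventually_nhds:
  assumes "isCont f x" "open S" "f x \<in> S"
  shows "\<forall>\<^sub>F t in nhds x. f t \<in> S"
proof -
  have "(f \<longlongrightarrow> f x) (nhds x)"
    using assms(1) by (simp add: isCont_def tendsto_at_iff_tendsto_nhds)
  then show ?thesis using assms(2,3) by (rule topological_tendstoD)
qed

lemma isCont_perp: "isCont f x \<Longrightarrow> isCont (\<lambda>t. perp (f t)) x"
  by (rule bounded_linear.isCont[of perp]) (auto simp: linear_conv_bounded_linear[symmetric] intro: linearI)

lemma periodic_orbit_mono:
  assumes "periodic_orbit X Y N \<Gamma>" "N \<subseteq> U"
  shows "periodic_orbit X Y U \<Gamma>"
proof -
  obtain \<gamma> T where "closed_trajectory X Y N \<gamma> T" "\<Gamma> = \<gamma> ` {0..T}"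
    using assms(1) by (auto simp: periodic_orbit_def)
  moreover from this have "closed_trajectory X Y U \<gamma> T"
    using assms(2) unfolding closed_trajectory_def trajectory_on_def
    by (elim conjE, intro conjI) (assumption | rule order_trans)+
  ultimately show ?thesis unfolding periodic_orbit_def by blast
qed

lemma periodic_orbit_subset: "periodic_orbit X Y N \<Gamma> \<Longrightarrow> \<Gamma> \<subseteq> N"
  by (auto simp: periodic_orbit_def closed_trajectory_def trajectory_on_def)

context saddle_frame
begin

text \<open>Since \<open>m t\<close> satisfies the inner midpoint condition for all \<open>t\<close>, varying \<open>t\<close> moves the whole
  orbit through nearby periodic orbits.\<close>

lemma nearby_periodic_orbit:
  assumes L1: "traceless_map L1 \<theta>1"
    and out: "arc_from L \<theta> c 1 p q b" and inn: "arc_from L1 \<theta>1 c1 (- 1) q p a"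
    and \<nu>: "good \<nu>" "m \<nu> \<noteq> 0" "m \<nu> \<bullet> m \<nu> < 1"
    and pq: "p = m \<nu> - half_chord (sgn \<nu>) (m \<nu>)" "q = m \<nu> + half_chord (sgn \<nu>) (m \<nu>)"
    and zero: "\<And>t. Q + t \<noteq> 0 \<Longrightarrow> P - t \<noteq> 0 \<Longrightarrow> m t \<bullet> L1 (m t - c1) = 0"
    and N: "open N" "\<And>s. s \<in> {0..b} \<Longrightarrow> flow L \<theta> c s p \<in> N"
      "\<And>s. s \<in> {0..a} \<Longrightarrow> flow L1 \<theta>1 c1 s q \<in> N"
  obtains \<Gamma> where "periodic_orbit (\<lambda>z. L1 (z - c1)) (\<lambda>z. L (z - c)) N \<Gamma>" "\<not> \<Gamma> \<inter> S1 \<subseteq> {p, q}"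
proof -
  define s where "s = sgn \<nu>"
  have "\<nu> \<noteq> 0" using \<nu>(1) by (auto simp: good_def)
  then have s2: "s\<^sup>2 = 1" and s0: "s \<noteq> 0" by (auto simp: s_def sgn_if)
  define d where "d t = s * sqrt ((1 - m t \<bullet> m t) / (m t \<bullet> m t))" for t
  define ps qs where "ps t = m t - half_chord s (m t)" and "qs t = m t + half_chord s (m t)" for t
  have half: "half_chord s (m t) = - d t *\<^sub>R perp (m t)" for t by (simp add: half_chord_def d_def)
  \<comment> \<open>The multipliers are solved from the chord relation for each field: the outer
    field at \<open>m t\<close> is \<open>- t\<close> times \<open>perp (m t)\<close>, and the half
    chord is \<open>- d t\<close> times it. The inner chord runs the opposite way.\<close>
  define \<kappa>2 where "\<kappa>2 t = t / d t" for t
  define \<kappa>1 where "\<kappa>1 t = (L1 (m t - c1) \<bullet> perp (m t)) / (m t \<bullet> m t) / d t" for t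
  have AB: "0 < P - \<nu>" "0 < Q + \<nu>" using \<nu>(1) by (auto simp: good_def)
  have mm: "0 < m \<nu> \<bullet> m \<nu>" using \<nu>(2) by simp
  have d0: "d \<nu> \<noteq> 0" using s0 mm \<nu>(3) by (simp add: d_def)
  have cm: "isCont m \<nu>" unfolding mid_def using AB by (intro continuous_intros) auto
  have cd: "isCont d \<nu>" unfolding d_def using mm by (intro continuous_intros cm) auto
  have chalf: "isCont (\<lambda>t. half_chord s (m t)) \<nu>" unfolding half by (intro continuous_intros cm cd isCont_perp)
  have cps: "isCont ps \<nu>" "isCont qs \<nu>" unfolding ps_def qs_def by (intro continuous_intros cm chalf)+
  have c\<kappa>2: "isCont \<kappa>2 \<nu>" unfolding \<kappa>2_def using d0 by (intro continuous_intros cd) auto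
  have "isCont (\<lambda>t. L1 (m t - c1)) \<nu>"
    by (intro bounded_linear.isCont[OF traceless_mapD(2)[OF L1]] continuous_intros cm)
  then have c\<kappa>1: "isCont \<kappa>1 \<nu>"
    unfolding \<kappa>1_def using d0 mm by (intro continuous_intros cd cm isCont_perp) auto
  have "\<forall>\<^sub>F t in nhds \<nu>. t \<in> {- Q<..<P}"
    using AB by (intro eventually_nhds_in_open) auto
  moreover have "\<forall>\<^sub>F t in nhds \<nu>. m t \<bullet> m t \<in> {0<..<1}"
    using mm \<nu>(3) by (intro isCont_eventually_nhds continuous_intros cm) auto
  ultimately have ev: "\<forall>\<^sub>F t in nhds \<nu>. 0 < P - t \<and> 0 < Q + t \<and> m t \<noteq> 0 \<and> m t \<bullet> m t < 1 \<and> d t \<noteq> 0"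
  proof eventually_elim
    case (elim t)
    then show ?case using s0 by (auto simp: d_def)
  qed
  have sum: "(1/2) *\<^sub>R (ps t + qs t) = m t" "(1/2) *\<^sub>R (qs t + ps t) = m t"
    "(1/2) *\<^sub>R (qs t - ps t) = - d t *\<^sub>R perp (m t)" "(1/2) *\<^sub>R (ps t - qs t) = d t *\<^sub>R perp (m t)" for t
    by (simp_all add: ps_def qs_def half vec_eq_iff)
  have ends: "ps \<nu> = p" "qs \<nu> = q" by (simp_all add: ps_def qs_def pq s_def)
  have ev2: "\<forall>\<^sub>F t in nhds \<nu>. ps t \<in> S1 \<and> qs t \<in> S1 \<and>
      L ((1/2) *\<^sub>R (ps t + qs t) - c) = \<kappa>2 t *\<^sub>R ((1/2) *\<^sub>R (qs t - ps t))"
    using ev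
  proof eventually_elim
    case (elim t)
    then show ?case
      using half_chord_in_S1[of "m t" s] s2 L_mid[of t]
      unfolding sum by (simp add: ps_def qs_def \<kappa>2_def)
  qed
  have ev1: "\<forall>\<^sub>F t in nhds \<nu>. qs t \<in> S1 \<and> ps t \<in> S1 \<and>
      L1 ((1/2) *\<^sub>R (qs t + ps t) - c1) = \<kappa>1 t *\<^sub>R ((1/2) *\<^sub>R (ps t - qs t))"
    using ev
  proof eventually_elim
    case (elim t)
    have "L1 (m t - c1) \<bullet> m t = 0" using zero[of t] elim by (simp add: inner_commute)
    then have "L1 (m t - c1) = ((L1 (m t - c1) \<bullet> perp (m t)) / (m t \<bullet> m t)) *\<^sub>R perp (m t)"
      using elim by (intro orthogonal_imp_perp) auto
    also have "\<dots> = \<kappa>1 t *\<^sub>R (d t *\<^sub>R perp (m t))" using elim by (simp add: \<kappa>1_def)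
    finally show ?case
      using half_chord_in_S1[of "m t" s] s2 elim unfolding sum by (simp add: ps_def qs_def)
  qed
  \<comment> \<open>The punctured filter provides a parameter different from \<nu>, needed to obtain
    a different orbit.\<close>
  have "\<forall>\<^sub>F t in at \<nu>. t \<noteq> \<nu>" by (simp add: eventually_at_filter)
  moreover have "\<forall>\<^sub>F t in at \<nu>. 0 < P - t \<and> 0 < Q + t \<and> m t \<noteq> 0 \<and> m t \<bullet> m t < 1 \<and> d t \<noteq> 0"
    using ev by (simp add: eventually_nhds_conv_at)
  moreover have "\<forall>\<^sub>F t in at \<nu>. ps t \<in> S1 \<and> qs t \<in> S1"
    using ev2 by (simp add: eventually_nhds_conv_at eventually_conj_iff)
  moreover have "\<forall>\<^sub>F t in at \<nu>. \<exists>b'>0. flow L \<theta> c b' (ps t) = qs t \<and>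
      (\<forall>s\<in>{0..b'}. 0 \<le> 1 * h (flow L \<theta> c s (ps t)) \<and> flow L \<theta> c s (ps t) \<in> N)"
    using perturb_arc[OF L out N(1,2) cps c\<kappa>2 ends ev2] by (simp add: eventually_nhds_conv_at)
  moreover have "\<forall>\<^sub>F t in at \<nu>. \<exists>a'>0. flow L1 \<theta>1 c1 a' (qs t) = ps t \<and>
      (\<forall>s\<in>{0..a'}. 0 \<le> (- 1) * h (flow L1 \<theta>1 c1 s (qs t)) \<and> flow L1 \<theta>1 c1 s (qs t) \<in> N)"
    using perturb_arc[OF L1 inn N(1,3) cps(2,1) c\<kappa>1 ends(2,1) ev1] by (simp add: eventually_nhds_conv_at)
  ultimately have "\<forall>\<^sub>F t in at \<nu>. \<exists>\<Gamma>. periodic_orbit (\<lambda>z. L1 (z - c1)) (\<lambda>z. L (z - c)) N \<Gamma> \<and> \<not> \<Gamma> \<inter> S1 \<subseteq> {p, q}"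
  proof eventually_elim
    case (elim t)
    obtain b' where b': "b' > 0" "flow L \<theta> c b' (ps t) = qs t"
      "\<And>s. s \<in> {0..b'} \<Longrightarrow> 0 \<le> h (flow L \<theta> c s (ps t)) \<and> flow L \<theta> c s (ps t) \<in> N"
      using elim(4) by auto
    obtain a' where a': "a' > 0" "flow L1 \<theta>1 c1 a' (qs t) = ps t"
      "\<And>s. s \<in> {0..a'} \<Longrightarrow> h (flow L1 \<theta>1 c1 s (qs t)) \<le> 0 \<and> flow L1 \<theta>1 c1 s (qs t) \<in> N"
      using elim(5) by auto
    have perp0: "perp (m t) \<noteq> 0"
    proof
      assume "perp (m t) = 0"
      then have "perp (m t) \<bullet> perp (m t) = 0" by simp
      then show False using elim(2) by simp
    qed
    have neq: "ps t \<noteq> qs t"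
    proof
      assume "ps t = qs t"
      then show False using sum(4)[of t] elim(2) perp0 by simp
    qed
    let ?\<Gamma> = "(\<lambda>s. flow L \<theta> c s (ps t)) ` {0..b'} \<union> (\<lambda>s. flow L1 \<theta>1 c1 s (qs t)) ` {0..a'}"
    have per: "periodic_orbit (\<lambda>z. L1 (z - c1)) (\<lambda>z. L (z - c)) N ?\<Gamma>"
      by (rule periodic_orbit_two_arcs[OF L1 L a'(1) b'(1) neq b'(2) a'(2) b'(3) a'(3)])
    have "ps t \<in> ?\<Gamma>" "qs t \<in> ?\<Gamma>"
      using a'(1) b'(1) by (auto intro!: image_eqI[of _ _ 0])
    have "\<not> ?\<Gamma> \<inter> S1 \<subseteq> {p, q}"
    proof
      assume "?\<Gamma> \<inter> S1 \<subseteq> {p, q}"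
      then have "ps t \<in> {p, q}" "qs t \<in> {p, q}"
        using \<open>ps t \<in> ?\<Gamma>\<close> \<open>qs t \<in> ?\<Gamma>\<close> elim(3) by blast+
      \<comment> \<open>Either matching gives the same midpoint, and the midpoint determines the
        parameter through the value of the outer field there.\<close>
      then have "ps t = p \<and> qs t = q \<or> ps t = q \<and> qs t = p" using neq by auto
      then have "ps t + qs t = ps \<nu> + qs \<nu>" unfolding ends by (elim disjE conjE) (simp_all add: add.commute)
      then have mt: "m t = m \<nu>" using sum(1)[of t] sum(1)[of \<nu>] by simp
      have "- t *\<^sub>R perp (m t) = L (m t - c)" using L_mid[of t] elim(2) by simp
      also have "\<dots> = - \<nu> *\<^sub>R perp (m t)" unfolding mt using L_mid[of \<nu>] AB by simp
      finally show False using perp0 elim(1) by (simp only: scaleR_cancel_right) simp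
    qed
    with per show ?case by (intro exI conjI)
  qed
  from eventually_happens'[OF at_neq_bot this] obtain t \<Gamma>
    where "periodic_orbit (\<lambda>z. L1 (z - c1)) (\<lambda>z. L (z - c)) N \<Gamma>" "\<not> \<Gamma> \<inter> S1 \<subseteq> {p, q}"
    by (elim exE conjE)
  then show ?thesis by (rule that)
qed

text \<open>Each cycle receives a good root \<nu> of \<open>f\<close>, and distinct cycles receive
  distinct roots. Three of them make \<open>f\<close> vanish identically, which contradicts
  isolation of any one cycle.\<close>

lemma limit_cycles_le_2:
  assumes L1: "traceless_map L1 \<theta>1" and U: "open U"
    and X: "X = (\<lambda>z. L1 (z - c1))" and Y: "Y = (\<lambda>z. L (z - c))"
  shows "finite {\<Gamma>. crossing_limit_cycle X Y U \<Gamma> \<and> card (\<Gamma> \<inter> S1) = 2} \<and>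
         card {\<Gamma>. crossing_limit_cycle X Y U \<Gamma> \<and> card (\<Gamma> \<inter> S1) = 2} \<le> 2"
proof -
  define orbit where "orbit p q a b \<nu> \<Gamma> \<longleftrightarrow>
      arc_from L \<theta> c 1 p q b \<and> arc_from L1 \<theta>1 c1 (- 1) q p a \<and>
      \<Gamma> = (\<lambda>t. flow L \<theta> c t p) ` {0..b} \<union> (\<lambda>t. flow L1 \<theta>1 c1 t q) ` {0..a} \<and>
      \<Gamma> \<inter> S1 = {p, q} \<and> \<Gamma> \<subseteq> U \<and> good \<nu> \<and> m \<nu> \<noteq> 0 \<and> m \<nu> \<bullet> m \<nu> < 1 \<and>
      p = m \<nu> - half_chord (sgn \<nu>) (m \<nu>) \<and> q = m \<nu> + half_chord (sgn \<nu>) (m \<nu>)" for p q a b \<nu> \<Gamma>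
  have ex: "\<exists>p q a b \<nu>. orbit p q a b \<nu> \<Gamma>"
    if \<Gamma>: "crossing_limit_cycle X Y U \<Gamma>" "card (\<Gamma> \<inter> S1) = 2" for \<Gamma>
  proof -
    have per: "crossing_periodic_orbit X Y U \<Gamma>" using \<Gamma>(1) by (simp add: crossing_limit_cycle_def)
    obtain p q a b where o: "arc_from L \<theta> c 1 p q b" "arc_from L1 \<theta>1 c1 (- 1) q p a"
      "\<Gamma> = (\<lambda>t. flow L \<theta> c t p) ` {0..b} \<union> (\<lambda>t. flow L1 \<theta>1 c1 t q) ` {0..a}"
      "\<Gamma> \<inter> S1 = {p, q}" "\<Gamma> \<subseteq> U"
      using crossing_periodic_orbit_two_arcs[OF L1 X L Y per \<Gamma>(2)] .
    obtain \<nu> where "good \<nu>" "m \<nu> \<noteq> 0" "m \<nu> \<bullet> m \<nu> < 1"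
      "p = m \<nu> - half_chord (sgn \<nu>) (m \<nu>)" "q = m \<nu> + half_chord (sgn \<nu>) (m \<nu>)"
      using outer_chord[OF o(1)] .
    with o have "orbit p q a b \<nu> \<Gamma>" unfolding orbit_def by (intro conjI)
    then show ?thesis by blast
  qed
  have orbitD: "arc_from L \<theta> c 1 p q b" "arc_from L1 \<theta>1 c1 (- 1) q p a"
      "\<Gamma> = (\<lambda>t. flow L \<theta> c t p) ` {0..b} \<union> (\<lambda>t. flow L1 \<theta>1 c1 t q) ` {0..a}"
      "\<Gamma> \<inter> S1 = {p, q}" "\<Gamma> \<subseteq> U" "good \<nu>" "m \<nu> \<noteq> 0" "m \<nu> \<bullet> m \<nu> < 1"
      "p = m \<nu> - half_chord (sgn \<nu>) (m \<nu>)" "q = m \<nu> + half_chord (sgn \<nu>) (m \<nu>)"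
    if "orbit p q a b \<nu> \<Gamma>" for p q a b \<nu> \<Gamma>
    using that unfolding orbit_def by - (elim conjE, assumption)+
  have uniq: "\<Gamma> = \<Gamma>'" if "orbit p q a b \<nu> \<Gamma>" "orbit p' q' a' b' \<nu> \<Gamma>'" for p q a b \<nu> \<Gamma> p' q' a' b' \<Gamma>'
  proof -
    have eqs: "p' = p" "q' = q" using orbitD(9,10)[OF that(1)] orbitD(9,10)[OF that(2)] by simp_all
    note arcs = orbitD(1,2)[OF that(1)] orbitD(1,2)[OF that(2), unfolded eqs]
    have "b = b'" "a = a'"
      using arc_from_unique[OF arcs(1,3)] arc_from_unique[OF arcs(2,4)] by simp_all
    then show ?thesis unfolding orbitD(3)[OF that(1)] orbitD(3)[OF that(2)] eqs by simp
  qed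
  define f where "f \<nu> = (u \<bullet> L1 u) * (X0^2 * (P - \<nu>)^2 - Y0^2 * (Q + \<nu>)^2) +
    (u \<bullet> L1 (perp u) + perp u \<bullet> L1 u) * (X0 * Y0 * ((P - \<nu>) * (Q + \<nu>))) -
    (u \<bullet> L1 c1) * (X0 * ((P - \<nu>)^2 * (Q + \<nu>))) - (perp u \<bullet> L1 c1) * (Y0 * ((P - \<nu>) * (Q + \<nu>)^2))" for \<nu>
  have root: "f \<nu> = 0" if "orbit p q a b \<nu> \<Gamma>" for p q a b \<nu> \<Gamma>
  proof -
    have "m \<nu> \<bullet> L1 (m \<nu> - c1) = 0"
      using inner_chord[OF L1 orbitD(2,9,10)[OF that]] .
    moreover have "Q + \<nu> \<noteq> 0" "P - \<nu> \<noteq> 0" using orbitD(6)[OF that] by (auto simp: good_def)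
    ultimately show ?thesis
      unfolding f_def inner_condition_cubic[OF L1 \<open>Q + \<nu> \<noteq> 0\<close> \<open>P - \<nu> \<noteq> 0\<close>, symmetric] by simp
  qed
  have not_all: "\<not> (\<forall>\<nu>. f \<nu> = 0)" if \<Gamma>: "crossing_limit_cycle X Y U \<Gamma>" "orbit p q a b \<nu> \<Gamma>" for p q a b \<nu> \<Gamma>
  proof
    assume f: "\<forall>\<nu>. f \<nu> = 0"
    have zero: "m t \<bullet> L1 (m t - c1) = 0" if "Q + t \<noteq> 0" "P - t \<noteq> 0" for t
    proof -
      have "((P - t) * (Q + t))\<^sup>2 * (m t \<bullet> L1 (m t - c1)) = f t"
        unfolding f_def by (rule inner_condition_cubic[OF L1 that])
      then show ?thesis using f that by simp
    qed
    obtain N where N: "open N" "\<Gamma> \<subseteq> N" "\<And>\<Gamma>'. periodic_orbit X Y U \<Gamma>' \<Longrightarrow> \<Gamma>' \<subseteq> N \<Longrightarrow> \<Gamma>' = \<Gamma>"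
      using \<Gamma>(1) by (auto simp: crossing_limit_cycle_def)
    note o = orbitD(1,2,6,7,8,9,10)[OF \<Gamma>(2)]
    note G = orbitD(3)[OF \<Gamma>(2)] and GS = orbitD(4)[OF \<Gamma>(2)] and GU = orbitD(5)[OF \<Gamma>(2)]
    \<comment> \<open>The perturbed orbit must lie in the isolating neighbourhood and also in the
      domain \<open>U\<close>, where periodic orbits are counted.\<close>
    have NU: "open (N \<inter> U)" using N(1) U by (rule open_Int)
    have NU2: "flow L \<theta> c s p \<in> N \<inter> U" if "s \<in> {0..b}" for s
      using that N(2) GU by (auto simp: G)
    have NU1: "flow L1 \<theta>1 c1 s q \<in> N \<inter> U" if "s \<in> {0..a}" for s
      using that N(2) GU by (auto simp: G)
    obtain \<Gamma>' where \<Gamma>': "periodic_orbit X Y (N \<inter> U) \<Gamma>'" "\<not> \<Gamma>' \<inter> S1 \<subseteq> {p, q}"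
      unfolding X Y by (rule nearby_periodic_orbit[OF L1 o zero NU NU2 NU1])
    have "\<Gamma>' = \<Gamma>"
      using N(3)[OF periodic_orbit_mono[OF \<Gamma>'(1)]] periodic_orbit_subset[OF \<Gamma>'(1)] by blast
    then show False using \<Gamma>'(2) GS by simp
  qed
  show ?thesis
  proof (rule finite_card_le_2I)
    fix \<Gamma>1 \<Gamma>2 \<Gamma>3
    assume "\<Gamma>1 \<in> {\<Gamma>. crossing_limit_cycle X Y U \<Gamma> \<and> card (\<Gamma> \<inter> S1) = 2}"
      "\<Gamma>2 \<in> {\<Gamma>. crossing_limit_cycle X Y U \<Gamma> \<and> card (\<Gamma> \<inter> S1) = 2}"
      "\<Gamma>3 \<in> {\<Gamma>. crossing_limit_cycle X Y U \<Gamma> \<and> card (\<Gamma> \<inter> S1) = 2}"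
    then have lc: "crossing_limit_cycle X Y U \<Gamma>1"
      and "\<exists>p q a b \<nu>. orbit p q a b \<nu> \<Gamma>1" "\<exists>p q a b \<nu>. orbit p q a b \<nu> \<Gamma>2" "\<exists>p q a b \<nu>. orbit p q a b \<nu> \<Gamma>3"
      using ex by auto
    then obtain p1 q1 a1 b1 \<nu>1 p2 q2 a2 b2 \<nu>2 p3 q3 a3 b3 \<nu>3 where
      o: "orbit p1 q1 a1 b1 \<nu>1 \<Gamma>1" "orbit p2 q2 a2 b2 \<nu>2 \<Gamma>2" "orbit p3 q3 a3 b3 \<nu>3 \<Gamma>3"
      by blast
    show "\<Gamma>1 = \<Gamma>2 \<or> \<Gamma>1 = \<Gamma>3 \<or> \<Gamma>2 = \<Gamma>3"
    proof (rule ccontr)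
      assume "\<not> (\<Gamma>1 = \<Gamma>2 \<or> \<Gamma>1 = \<Gamma>3 \<or> \<Gamma>2 = \<Gamma>3)"
      then have dist: "\<nu>1 \<noteq> \<nu>2" "\<nu>1 \<noteq> \<nu>3" "\<nu>2 \<noteq> \<nu>3" 
        using uniq[OF o(1), of p2 q2 a2 b2 \<Gamma>2] uniq[OF o(1), of p3 q3 a3 b3 \<Gamma>3]
          uniq[OF o(2), of p3 q3 a3 b3 \<Gamma>3] o(2,3) by auto
      have g: "good \<nu>1" "good \<nu>2" "good \<nu>3" using orbitD(6)[OF o(1)] orbitD(6)[OF o(2)] orbitD(6)[OF o(3)] by simp_all
      have "f \<nu> = 0" for \<nu>
        using three_chords_cubic_vanishes[OF PQ g[unfolded good_def]
            root[OF o(1), unfolded f_def] root[OF o(2), unfolded f_def] root[OF o(3), unfolded f_def] dist]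
        by (simp add: f_def)
      then show False using not_all[OF lc o(1)] by blast
    qed
  qed
qed

end

theorem theoremC:
  fixes U :: "plane set" and X Y :: vfield
  assumes "open U" and "convex U" and "0 \<in> U" and "S1 \<subseteq> U"
    and "(X, Y) \<in> class3 U \<union> class4 U"
  shows "finite {\<Gamma>. crossing_limit_cycle X Y U \<Gamma> \<and> card (\<Gamma> \<inter> S1) = 2} \<and>
         card {\<Gamma>. crossing_limit_cycle X Y U \<Gamma> \<and> card (\<Gamma> \<inter> S1) = 2} \<le> 2"
proof -
  \<comment> \<open>The divergence of an affine field is constant, so its value at the point 0 of
    \<open>U\<close> fixes the trace; for a center, trace zero comes from the eigenvalues.\<close>
  have "linear_center X \<or> linear_saddle X \<and> div_field X 0 = 0"
    and Y: "linear_saddle Y" "div_field Y 0 = 0"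
    using assms(3,5) by (auto simp: class3_def class4_def)
  then obtain L1 \<theta>1 c1 where L1: "traceless_map L1 \<theta>1" "X = (\<lambda>z. L1 (z - c1))"
    using linear_center_traceless linear_saddle_traceless by metis
  obtain L2 \<theta>2 c2 where L2: "traceless_map L2 \<theta>2" "\<theta>2 > 0" "Y = (\<lambda>z. L2 (z - c2))"
    using linear_saddle_traceless[OF Y] .
  obtain u P Q where "u \<bullet> u = 1" "0 < P" "0 < Q" "L2 u = Q *\<^sub>R perp u" "L2 (perp u) = P *\<^sub>R u"
    using traceless_saddle_basis[OF L2(1,2)] .
  then have "saddle_frame L2 \<theta>2 u P Q"
    using L2 by unfold_locales
  then show ?thesis
    using saddle_frame.limit_cycles_le_2[OF _ L1(1) assms(1) L1(2) L2(3)] by simp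
qed

end
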